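(* There exist Delone sets of finite local complexity that are topologically conjugate to Meyer sets but are not themselves Meyer sets.
   Context: A Delone set is a uniformly discrete, relatively dense subset of $\mathbb{R}^d$ (for some $d\geq 1$); it has finite local complexity (FLC) if for each $R>0$ it has only finitely many patches of radius $R$ up to translation. The hull $\Omega_\Lambda$ is the closure of $\{\Lambda-x:x\in\mathbb{R}^d\}$ in the usual tiling metric (two point sets are at distance at most $\delta$ if they agree on the ball of radius $1/\delta$ about $0$ up to a translation of size at most $\delta$), with $\mathbb{R}^d$ acting by translation. Two Delone sets in $\mathbb{R}^d$ are topologically conjugate if there is an $\mathbb{R}^d$-equivariant homeomorphism between their hulls. A Meyer set is a relatively dense harmonious subset $\Lambda\subset\mathbb{R}^d$, where harmonious means: for every group homomorphism $\phi:\langle\Lambda\rangle\to S^1$ and every $\epsilon>0$ there is $\beta\in{\mathbb{R}^d}^*$ with $|\phi(a)-e^{2\pi i\beta(a)}|<\epsilon$ for all $a\in\Lambda$. Equivalently, $\Lambda$ is relatively dense and $\Lambda-\Lambda$ is uniformly discrete. *)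

theory Defs
  imports
    "HOL-Analysis.Analysis"
    "HOL-Computational_Algebra.Group_Closure"
    "HOL-Library.Function_Algebras"
begin

text \<open>
  The dimension is existentially quantified in the theorem, so it cannot be a type. Points of
  $d$-dimensional space are therefore the functions \<open>nat \<Rightarrow> real\<close> vanishing from index \<open>d\<close> on, as in
  the library's \<^const>\<open>Euclidean_space\<close>; addition is the pointwise addition of functions. The
  \<^class>\<open>metric_space\<close> instance of \<open>nat \<Rightarrow> real\<close> is not the Euclidean metric and is not used.
\<close>

definition Rn :: "nat \<Rightarrow> (nat \<Rightarrow> real) set" where
  "Rn d = topspace (Euclidean_space d)"

definition enorm :: "nat \<Rightarrow> (nat \<Rightarrow> real) \<Rightarrow> real" where
  "enorm d x = L2_set x {..<d}"

definition eball :: "nat \<Rightarrow> (nat \<Rightarrow> real) \<Rightarrow> real \<Rightarrow> (nat \<Rightarrow> real) set" where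
  "eball d x R = {y \<in> Rn d. enorm d (y - x) \<le> R}"

definition translate :: "(nat \<Rightarrow> real) \<Rightarrow> (nat \<Rightarrow> real) set \<Rightarrow> (nat \<Rightarrow> real) set" where
  "translate t A = (\<lambda>a. a + t) ` A"


section \<open>Delone sets and finite local complexity\<close>

definition uniformly_discrete :: "nat \<Rightarrow> (nat \<Rightarrow> real) set \<Rightarrow> bool" where
  "uniformly_discrete d A \<longleftrightarrow> (\<exists>r>0. \<forall>x\<in>A. \<forall>y\<in>A. x \<noteq> y \<longrightarrow> r \<le> enorm d (x - y))"

definition relatively_dense :: "nat \<Rightarrow> (nat \<Rightarrow> real) set \<Rightarrow> bool" where
  "relatively_dense d A \<longleftrightarrow> (\<exists>R>0. \<forall>x\<in>Rn d. A \<inter> eball d x R \<noteq> {})"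

definition delone :: "nat \<Rightarrow> (nat \<Rightarrow> real) set \<Rightarrow> bool" where
  "delone d A \<longleftrightarrow> A \<subseteq> Rn d \<and> uniformly_discrete d A \<and> relatively_dense d A"

definition finite_local_complexity :: "nat \<Rightarrow> (nat \<Rightarrow> real) set \<Rightarrow> bool" where
  "finite_local_complexity d A \<longleftrightarrow>
     (\<forall>R>0. \<exists>\<P>. finite \<P> \<and>
        (\<forall>x\<in>Rn d. \<exists>P\<in>\<P>. \<exists>t\<in>Rn d. A \<inter> eball d x R = translate t P))"


section \<open>The tiling metric and hulls\<close>

text \<open>
  Both sets are moved, each by at most half of \<open>\<delta>\<close>, so that the relation is symmetric while the
  relative translation has size at most \<open>\<delta>\<close>. Capping the infimum at 1 gives the triangle inequality.
\<close>

definition agree_up_to :: "nat \<Rightarrow> real \<Rightarrow> (nat \<Rightarrow> real) set \<Rightarrow> (nat \<Rightarrow> real) set \<Rightarrow> bool" where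
  "agree_up_to d \<delta> A B \<longleftrightarrow>
     (\<exists>s\<in>Rn d. \<exists>t\<in>Rn d. enorm d s \<le> \<delta> / 2 \<and> enorm d t \<le> \<delta> / 2 \<and>
        translate s A \<inter> eball d 0 (1 / \<delta>) = translate t B \<inter> eball d 0 (1 / \<delta>))"

definition tiling_dist :: "nat \<Rightarrow> (nat \<Rightarrow> real) set \<Rightarrow> (nat \<Rightarrow> real) set \<Rightarrow> real" where
  "tiling_dist d A B = Inf (insert 1 {\<delta>. 0 < \<delta> \<and> agree_up_to d \<delta> A B})"

definition tiling_topology :: "nat \<Rightarrow> (nat \<Rightarrow> real) set topology" where
  "tiling_topology d = Metric_space.mtopology (Collect (delone d)) (tiling_dist d)"

text \<open>
  The closure is taken among Delone sets; a limit in the tiling metric of translates of a Delone set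
  is again Delone, with the same constants.
\<close>

definition tiling_hull :: "nat \<Rightarrow> (nat \<Rightarrow> real) set \<Rightarrow> (nat \<Rightarrow> real) set set" where
  "tiling_hull d A = tiling_topology d closure_of {translate (- x) A | x. x \<in> Rn d}"

definition topologically_conjugate ::
  "nat \<Rightarrow> (nat \<Rightarrow> real) set \<Rightarrow> (nat \<Rightarrow> real) set \<Rightarrow> bool" where
  "topologically_conjugate d A B \<longleftrightarrow>
     (\<exists>h. homeomorphic_map (subtopology (tiling_topology d) (tiling_hull d A))
                           (subtopology (tiling_topology d) (tiling_hull d B)) h \<and>
          (\<forall>P\<in>tiling_hull d A. \<forall>x\<in>Rn d. h (translate x P) = translate x (h P)))"


section \<open>Meyer sets\<close>

definition circle_hom :: "(nat \<Rightarrow> real) set \<Rightarrow> ((nat \<Rightarrow> real) \<Rightarrow> complex) \<Rightarrow> bool" where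
  "circle_hom G \<phi> \<longleftrightarrow>
     (\<forall>a\<in>G. cmod (\<phi> a) = 1) \<and> (\<forall>a\<in>G. \<forall>b\<in>G. \<phi> (a + b) = \<phi> a * \<phi> b)"

definition linear_functional :: "nat \<Rightarrow> ((nat \<Rightarrow> real) \<Rightarrow> real) \<Rightarrow> bool" where
  "linear_functional d \<beta> \<longleftrightarrow>
     (\<forall>x\<in>Rn d. \<forall>y\<in>Rn d. \<beta> (x + y) = \<beta> x + \<beta> y) \<and>
     (\<forall>c. \<forall>x\<in>Rn d. \<beta> (\<lambda>i. c * x i) = c * \<beta> x)"

definition harmonious :: "nat \<Rightarrow> (nat \<Rightarrow> real) set \<Rightarrow> bool" where
  "harmonious d A \<longleftrightarrow>
     (\<forall>\<phi>. circle_hom (group_closure A) \<phi> \<longrightarrow>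
        (\<forall>\<epsilon>>0. \<exists>\<beta>. linear_functional d \<beta> \<and>
           (\<forall>a\<in>A. cmod (\<phi> a - exp (2 * of_real pi * \<i> * of_real (\<beta> a))) < \<epsilon>)))"

definition meyer :: "nat \<Rightarrow> (nat \<Rightarrow> real) set \<Rightarrow> bool" where
  "meyer d A \<longleftrightarrow> A \<subseteq> Rn d \<and> relatively_dense d A \<and> harmonious d A"


section \<open>The tiling metric is a metric\<close>

lemma Rn_add: "x \<in> Rn d \<Longrightarrow> y \<in> Rn d \<Longrightarrow> x + y \<in> Rn d"
  and Rn_diff: "x \<in> Rn d \<Longrightarrow> y \<in> Rn d \<Longrightarrow> x - y \<in> Rn d"
  and Rn_minus: "x \<in> Rn d \<Longrightarrow> - x \<in> Rn d"
  and Rn_0: "0 \<in> Rn d"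
  by (auto simp: Rn_def topspace_Euclidean_space)

lemma enorm_nonneg: "0 \<le> enorm d x"
  by (simp add: enorm_def)

lemma enorm_minus: "enorm d (- x) = enorm d x"
  by (simp add: enorm_def L2_set_def)

lemma enorm_0: "enorm d 0 = 0"
  by (simp add: enorm_def L2_set_def)

lemma enorm_triangle: "enorm d (x + y) \<le> enorm d x + enorm d y"
  using L2_set_triangle_ineq[of x y "{..<d}"] by (simp add: enorm_def plus_fun_def)

lemma enorm_triangle_diff: "enorm d (x - y) \<le> enorm d x + enorm d y"
  using enorm_triangle[of d x "- y"] by (simp add: enorm_minus)

lemma enorm_eq_0: "x \<in> Rn d \<Longrightarrow> enorm d x = 0 \<longleftrightarrow> x = 0"
  by (simp add: enorm_def L2_set_eq_0_iff Rn_def topspace_Euclidean_space fun_eq_iff)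
     (metis lessThan_iff not_less)

lemma mem_translate: "x \<in> translate t A \<longleftrightarrow> x - t \<in> A"
  by (force simp: translate_def)

lemma mem_eball_0: "x \<in> eball d 0 R \<longleftrightarrow> x \<in> Rn d \<and> enorm d x \<le> R"
  by (simp add: eball_def)

lemma agree_up_to_sym: "agree_up_to d \<delta> A B \<longleftrightarrow> agree_up_to d \<delta> B A"
  unfolding agree_up_to_def by blast

lemma agree_up_to_refl: "0 < \<delta> \<Longrightarrow> agree_up_to d \<delta> A A"
  unfolding agree_up_to_def by (intro bexI[of _ 0]) (auto simp: Rn_0 enorm_0)

lemma tiling_dist_bdd: "bdd_below (insert 1 {\<delta>. 0 < \<delta> \<and> agree_up_to d \<delta> A B})"
  by (intro bdd_belowI[of _ 0]) auto

lemma tiling_dist_nonneg: "0 \<le> tiling_dist d A B"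
  unfolding tiling_dist_def by (rule cInf_greatest) auto

lemma tiling_dist_le_1: "tiling_dist d A B \<le> 1"
  unfolding tiling_dist_def by (rule cInf_lower[OF _ tiling_dist_bdd]) simp

lemma tiling_dist_le: "0 < \<delta> \<Longrightarrow> agree_up_to d \<delta> A B \<Longrightarrow> tiling_dist d A B \<le> \<delta>"
  unfolding tiling_dist_def by (rule cInf_lower[OF _ tiling_dist_bdd]) simp

lemma tiling_dist_lessD:
  assumes "tiling_dist d A B < e" "e \<le> 1"
  obtains \<delta> where "0 < \<delta>" "\<delta> < e" "agree_up_to d \<delta> A B"
proof -
  have "\<exists>\<delta>\<in>insert 1 {\<delta>. 0 < \<delta> \<and> agree_up_to d \<delta> A B}. \<delta> < e"
    using cInf_less_iff[THEN iffD1, OF insert_not_empty tiling_dist_bdd assms(1)[unfolded tiling_dist_def]] .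
  with assms(2) that show ?thesis by auto
qed

lemma agree_up_to_trans:
  assumes "agree_up_to d \<delta> A B" "agree_up_to d \<eta> B C"
    and "0 < \<delta>" "0 < \<eta>" "\<delta> + \<eta> \<le> 1"
  shows "agree_up_to d (\<delta> + \<eta>) A C"
proof -
  obtain s t where st: "s \<in> Rn d" "t \<in> Rn d" "enorm d s \<le> \<delta> / 2" "enorm d t \<le> \<delta> / 2"
    "\<And>z. z \<in> Rn d \<Longrightarrow> enorm d z \<le> 1 / \<delta> \<Longrightarrow> z - s \<in> A \<longleftrightarrow> z - t \<in> B"
    using assms(1) unfolding agree_up_to_def set_eq_iff by (auto simp: mem_translate mem_eball_0)
  obtain u v where uv: "u \<in> Rn d" "v \<in> Rn d" "enorm d u \<le> \<eta> / 2" "enorm d v \<le> \<eta> / 2"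
    "\<And>z. z \<in> Rn d \<Longrightarrow> enorm d z \<le> 1 / \<eta> \<Longrightarrow> z - u \<in> B \<longleftrightarrow> z - v \<in> C"
    using assms(2) unfolding agree_up_to_def set_eq_iff by (auto simp: mem_translate mem_eball_0)
  have radius: "1 / (a + b) + b / 2 \<le> 1 / a" if "0 < a" "0 < b" "a + b \<le> 1" for a b :: real
  proof -
    have "a * (a + b) \<le> 1 * 1" using that by (intro mult_mono) auto
    then have "b * (a * (a + b)) \<le> b * 1" using that by (intro mult_left_mono) auto
    moreover have "1 / a - 1 / (a + b) = b / (a * (a + b))" using that by (simp add: field_simps)
    moreover have "b \<le> b / (a * (a + b))"
      using calculation that by (subst pos_le_divide_eq) (auto intro: mult_pos_pos)
    ultimately show ?thesis using that by linarith
  qed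
  have "z - (s + u) \<in> A \<longleftrightarrow> z - (t + v) \<in> C"
    if z: "z \<in> Rn d" "enorm d z \<le> 1 / (\<delta> + \<eta>)" for z
  proof -
    have "enorm d (z - u) \<le> 1 / \<delta>"
      using enorm_triangle_diff[of d z u] radius[of \<delta> \<eta>] uv z assms by linarith
    then have "z - u - s \<in> A \<longleftrightarrow> z - u - t \<in> B"
      using st(5) uv(1) z(1) Rn_diff by blast
    moreover have "enorm d (z - t) \<le> 1 / \<eta>"
      using enorm_triangle_diff[of d z t] radius[of \<eta> \<delta>] st z assms by (simp add: add.commute)
    then have "z - t - u \<in> B \<longleftrightarrow> z - t - v \<in> C"
      using uv(5) st(2) z(1) Rn_diff by blast
    ultimately show ?thesis by (simp add: algebra_simps)
  qed
  moreover have "enorm d (s + u) \<le> (\<delta> + \<eta>) / 2" "enorm d (t + v) \<le> (\<delta> + \<eta>) / 2"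
    using enorm_triangle[of d s u] enorm_triangle[of d t v] st uv by (simp_all add: field_simps)
  ultimately show ?thesis
    unfolding agree_up_to_def set_eq_iff using st(1,2) uv(1,2)
    by (intro bexI[of _ "s + u"] bexI[of _ "t + v"]) (auto simp: mem_translate mem_eball_0 Rn_add)
qed

lemma tiling_dist_triangle: "tiling_dist d A C \<le> tiling_dist d A B + tiling_dist d B C"
proof (rule field_le_epsilon)
  fix e :: real assume e: "0 < e"
  let ?a = "tiling_dist d A B" and ?b = "tiling_dist d B C"
  show "tiling_dist d A C \<le> ?a + ?b + e"
  proof (cases "?a + ?b + e \<le> 1")
    case True
    obtain \<delta> where \<delta>: "0 < \<delta>" "\<delta> < ?a + e / 2" "agree_up_to d \<delta> A B"
      using tiling_dist_lessD[of d A B "?a + e / 2"] True e tiling_dist_nonneg[of d B C] by auto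
    obtain \<eta> where \<eta>: "0 < \<eta>" "\<eta> < ?b + e / 2" "agree_up_to d \<eta> B C"
      using tiling_dist_lessD[of d B C "?b + e / 2"] True e tiling_dist_nonneg[of d A B] by auto
    have "tiling_dist d A C \<le> \<delta> + \<eta>"
      using \<delta> \<eta> True by (intro tiling_dist_le agree_up_to_trans) auto
    with \<delta> \<eta> show ?thesis by linarith
  next
    case False
    with tiling_dist_le_1[of d A C] show ?thesis by linarith
  qed
qed

lemma tiling_dist_0_subset:
  assumes "delone d A" "delone d B" "tiling_dist d A B = 0"
  shows "A \<subseteq> B"
proof
  fix a assume a: "a \<in> A"
  have sub: "A \<subseteq> Rn d" "B \<subseteq> Rn d" using assms by (auto simp: delone_def)
  have close: "\<exists>b\<in>B. enorm d (a - b) \<le> e" if "0 < e" for e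
  proof -
    define k where "k = min (min e 1) (1 / (enorm d a + 1))"
    have k: "0 < k" "k \<le> e" "k \<le> 1" "k \<le> 1 / (enorm d a + 1)"
      using that enorm_nonneg[of d a] by (auto simp: k_def)
    then obtain \<delta> where \<delta>: "0 < \<delta>" "\<delta> < k" "agree_up_to d \<delta> A B"
      using tiling_dist_lessD[of d A B k] assms(3) by auto
    then obtain s t where st: "s \<in> Rn d" "t \<in> Rn d" "enorm d s \<le> \<delta> / 2" "enorm d t \<le> \<delta> / 2"
      "\<And>z. z \<in> Rn d \<Longrightarrow> enorm d z \<le> 1 / \<delta> \<Longrightarrow> z - s \<in> A \<longleftrightarrow> z - t \<in> B"
      unfolding agree_up_to_def set_eq_iff by (auto simp: mem_translate mem_eball_0)
    have "\<delta> * (enorm d a + 1) \<le> 1"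
    proof -
      have "\<delta> * (enorm d a + 1) \<le> 1 / (enorm d a + 1) * (enorm d a + 1)"
        using \<delta> k enorm_nonneg[of d a] by (intro mult_right_mono) auto
      then show ?thesis using enorm_nonneg[of d a] by simp
    qed
    then have "enorm d a + 1 \<le> 1 / \<delta>" using \<delta> by (simp add: field_simps)
    then have "enorm d (a + s) \<le> 1 / \<delta>"
      using enorm_triangle[of d a s] st \<delta> k by linarith
    then have "a + s - t \<in> B" using st(5)[of "a + s"] a sub st(1) by (auto intro: Rn_add)
    moreover have "enorm d (a - (a + s - t)) \<le> e"
      using enorm_triangle_diff[of d t s] st \<delta> k by (simp add: algebra_simps)
    ultimately show ?thesis by blast
  qed
  obtain r where r: "0 < r" "\<And>x y. x \<in> B \<Longrightarrow> y \<in> B \<Longrightarrow> x \<noteq> y \<Longrightarrow> r \<le> enorm d (x - y)"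
    using assms(2) unfolding delone_def uniformly_discrete_def by blast
  obtain b where b: "b \<in> B" "enorm d (a - b) \<le> r / 3" using close[of "r / 3"] r by auto
  show "a \<in> B"
  proof (rule ccontr)
    assume "a \<notin> B"
    then have "a \<noteq> b" using b by blast
    then have pos: "0 < enorm d (a - b)"
      using enorm_eq_0[of "a - b" d] enorm_nonneg[of d "a - b"] Rn_diff a b sub by fastforce
    obtain c where c: "c \<in> B" "enorm d (a - c) \<le> min (r / 3) (enorm d (a - b) / 2)"
      using close[of "min (r / 3) (enorm d (a - b) / 2)"] r pos by auto
    then have "b \<noteq> c" using pos by auto
    then have "r \<le> enorm d (c - b)" using r b c by auto
    moreover have "enorm d (c - b) \<le> enorm d (a - b) + enorm d (a - c)"
      using enorm_triangle_diff[of d "a - b" "a - c"] by simp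
    ultimately show False using b c r by linarith
  qed
qed

lemma tiling_dist_sym: "tiling_dist d A B = tiling_dist d B A"
  unfolding tiling_dist_def by (simp add: agree_up_to_sym)

lemma Metric_space_tiling: "Metric_space (Collect (delone d)) (tiling_dist d)"
proof
  show "tiling_dist d A B = tiling_dist d B A" for A B
    by (rule tiling_dist_sym)
  show "tiling_dist d A B = 0 \<longleftrightarrow> A = B"
    if "A \<in> Collect (delone d)" "B \<in> Collect (delone d)" for A B
  proof
    assume "tiling_dist d A B = 0"
    with that show "A = B"
      using tiling_dist_0_subset[of d A B] tiling_dist_0_subset[of d B A] tiling_dist_sym by auto
  next
    assume "A = B"
    then have "tiling_dist d A B \<le> 0 + e" if "0 < e" for e
      using that by (auto intro: tiling_dist_le agree_up_to_refl)
    then show "tiling_dist d A B = 0"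
      using field_le_epsilon[of "tiling_dist d A B" 0] tiling_dist_nonneg[of d A B] by auto
  qed
qed (auto intro: tiling_dist_nonneg tiling_dist_triangle)

end

theory Submission
  imports Defs
begin

text \<open>
  Let $\alpha = \sqrt 2 - 1$ and let $f(n)$ be $0$ for $n < 0$ and the fractional part of $n\alpha$
  for $n \ge 0$. Mark each index by the type of the step of $f$ taken there (constant, $+\alpha$,
  $+\alpha - 1$), and write the mark next to the point at position $6n + f(n)$ (set $A$) or $6n$
  (set $B$) as a further point at distance $1$ or $2$.

  Since the orbits of the rotation by $\alpha$ are uniformly dense in the circle, a long enough
  window of marks determines $f(n)$ up to any prescribed error. Hence translates of $A$ and of $B$
  are close simultaneously, and the correspondence $A - x \leftrightarrow B - x$ extends to the
  hulls. $B$ consists of integers, so it is Meyer. In $A$, the negative half and the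
  rotation half combine to differences of differences equal to $\alpha^{2k+1} = q\alpha - p$
  with $q$ odd. These tend to $0$, although the homomorphism $p + q\alpha \mapsto (-1)^q$ is $-1$
  on all of them; so $A$ is not harmonious.
\<close>

section \<open>Completeness of the tiling metric\<close>

text \<open>The break at 0 is what destroys the Meyer property. For the rotation on all integers,
  two base points k indices apart would differ by \<open>6k + frac (k \<alpha>)\<close> or by 1
  less, and the resulting set would again be Meyer. With f = 0 on the left, a pair straddling 0 has
  difference \<open>6k + f(n)\<close> for an arbitrary n with 0 \<le> n < k, and these values crowd
  together as k grows. The displacement f is a uniform limit of functions of finite windows of marks
  without being such a function, since it takes infinitely many values. The uniform limit is enough
  for a conjugacy. As the steps of f take only three values, A still has finite local complexity.
  The marks are what gives B a record of f: the points 6n alone are periodic. \<alpha> is a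
  quadratic unit, so its powers are explicit small elements \<open>q \<alpha> - p\<close> whose
  parity can be followed by a recursion.\<close>

definition delone_with :: "nat \<Rightarrow> real \<Rightarrow> real \<Rightarrow> (nat \<Rightarrow> real) set \<Rightarrow> bool" where
  "delone_with d r R A \<longleftrightarrow> A \<subseteq> Rn d \<and> (\<forall>x\<in>A. \<forall>y\<in>A. x \<noteq> y \<longrightarrow> r \<le> enorm d (x - y)) \<and>
     (\<forall>x\<in>Rn d. A \<inter> eball d x R \<noteq> {})"

lemma delone_iff_delone_with: "delone d A \<longleftrightarrow> (\<exists>r>0. \<exists>R>0. delone_with d r R A)"
  unfolding delone_def uniformly_discrete_def relatively_dense_def delone_with_def
  by (rule iffI; elim conjE exE; intro exI conjI; assumption)

lemma delone_with_translate:
  assumes "delone_with d r R A" "t \<in> Rn d"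
  shows "delone_with d r R (translate t A)"
  unfolding delone_with_def
proof (intro conjI ballI impI)
  show "translate t A \<subseteq> Rn d"
    using assms by (auto simp: delone_with_def translate_def intro: Rn_add)
next
  fix x y assume "x \<in> translate t A" "y \<in> translate t A" "x \<noteq> y"
  then have "x - t \<in> A" "y - t \<in> A" "x - t \<noteq> y - t" by (simp_all add: mem_translate)
  then have "r \<le> enorm d ((x - t) - (y - t))"
    using assms(1) unfolding delone_with_def by blast
  then show "r \<le> enorm d (x - y)" by simp
next
  fix x assume "x \<in> Rn d"
  then have "A \<inter> eball d (x - t) R \<noteq> {}"
    using assms Rn_diff unfolding delone_with_def by simp
  then obtain a where "a \<in> A" "a \<in> eball d (x - t) R" by blast
  then have "a + t \<in> translate t A \<inter> eball d x R"
    using assms(2) by (auto simp: mem_translate eball_def algebra_simps intro: Rn_add)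
  then show "translate t A \<inter> eball d x R \<noteq> {}" by blast
qed

lemma delone_translate: "delone d A \<Longrightarrow> t \<in> Rn d \<Longrightarrow> delone d (translate t A)"
  unfolding delone_iff_delone_with using delone_with_translate by metis

lemma translate_translate: "translate s (translate t A) = translate (s + t) A"
  by (auto simp: mem_translate set_eq_iff algebra_simps)

lemma translate_0: "translate 0 A = A"
  by (auto simp: mem_translate set_eq_iff)

text \<open>Moving only one set, by a single vector, gives up the symmetry of
  \<open>agree_up_to\<close>; in exchange the shifts along a sequence of sets simply add up, which
  the limit construction relies on.\<close>

definition shift_agree ::
  "nat \<Rightarrow> real \<Rightarrow> (nat \<Rightarrow> real) \<Rightarrow> (nat \<Rightarrow> real) set \<Rightarrow> (nat \<Rightarrow> real) set \<Rightarrow> bool" where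
  "shift_agree d \<rho> c A B \<longleftrightarrow> (\<forall>z\<in>Rn d. enorm d z \<le> \<rho> \<longrightarrow> (z \<in> A \<longleftrightarrow> z + c \<in> B))"

lemma shift_agree_mono: "shift_agree d \<rho> c A B \<Longrightarrow> \<rho>' \<le> \<rho> \<Longrightarrow> shift_agree d \<rho>' c A B"
  unfolding shift_agree_def by auto

lemma shift_agree_translate:
  assumes "shift_agree d \<rho> c A B" "t \<in> Rn d"
  shows "shift_agree d (\<rho> - enorm d t) c (translate t A) (translate t B)"
  unfolding shift_agree_def
proof (intro ballI impI)
  fix z assume z: "z \<in> Rn d" "enorm d z \<le> \<rho> - enorm d t"
  then have "enorm d (z - t) \<le> \<rho>"
    using enorm_triangle_diff[of d z t] by linarith
  then have "z - t \<in> A \<longleftrightarrow> z - t + c \<in> B"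
    using assms z Rn_diff unfolding shift_agree_def by blast
  then show "z \<in> translate t A \<longleftrightarrow> z + c \<in> translate t B"
    by (simp add: mem_translate algebra_simps)
qed

text \<open>Undoing the translation \<open>s\<close> on both sides leaves the single shift
  \<open>s - t\<close>. The ball is recentred by \<open>s\<close>, of size at most
  \<open>\<delta> / 2\<close>, and the 1 taken off the radius covers this because
  \<open>e \<le> 1\<close>.\<close>

lemma tiling_dist_lessE:
  assumes "tiling_dist d A B < e" "e \<le> 1"
  obtains c where "c \<in> Rn d" "enorm d c \<le> e" "shift_agree d (1 / e - 1) c A B"
proof -
  obtain \<delta> where \<delta>: "0 < \<delta>" "\<delta> < e" "agree_up_to d \<delta> A B"
    using tiling_dist_lessD[OF assms] by blast
  then obtain s t where st: "s \<in> Rn d" "t \<in> Rn d" "enorm d s \<le> \<delta> / 2" "enorm d t \<le> \<delta> / 2"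
    "\<And>z. z \<in> Rn d \<Longrightarrow> enorm d z \<le> 1 / \<delta> \<Longrightarrow> z - s \<in> A \<longleftrightarrow> z - t \<in> B"
    unfolding agree_up_to_def set_eq_iff by (auto simp: mem_translate mem_eball_0)
  show ?thesis
  proof
    show "s - t \<in> Rn d" using st Rn_diff by blast
    show "enorm d (s - t) \<le> e" using enorm_triangle_diff[of d s t] st \<delta> by linarith
    show "shift_agree d (1 / e - 1) (s - t) A B"
      unfolding shift_agree_def
    proof (intro ballI impI)
      fix z assume z: "z \<in> Rn d" "enorm d z \<le> 1 / e - 1"
      have "1 / e \<le> 1 / \<delta>" using \<delta> by (intro divide_left_mono) auto
      then have "enorm d (z + s) \<le> 1 / \<delta>"
        using enorm_triangle[of d z s] z st \<delta> assms by linarith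
      from st(5)[OF _ this] show "z \<in> A \<longleftrightarrow> z + (s - t) \<in> B"
        using z st(1) Rn_add by (simp add: algebra_simps)
    qed
  qed
qed

lemma tiling_dist_leI:
  assumes "0 < e" "c \<in> Rn d" "enorm d c \<le> e / 2" "shift_agree d (1 / e) c A B"
  shows "tiling_dist d A B \<le> e"
proof (rule tiling_dist_le)
  show "agree_up_to d e A B"
    unfolding agree_up_to_def
    using assms by (intro bexI[of _ 0] bexI[of _ "- c"])
      (auto simp: shift_agree_def mem_translate mem_eball_0 enorm_minus enorm_0 Rn_0 Rn_minus)
qed fact

text \<open>Each condition involves only a bounded region, and there \<open>C\<close> is an exact
  translate of a nearby \<open>P\<close>. Translation preserves distances, so \<open>r\<close> and
  \<open>R\<close> are inherited without loss.\<close>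

lemma delone_with_limit:
  assumes "C \<subseteq> Rn d" and R: "0 < R"
    and lim: "\<And>e. 0 < e \<Longrightarrow> \<exists>P. delone_with d r R P \<and> tiling_dist d C P < e"
  shows "delone_with d r R C"
proof -
  have near: "\<exists>P c. delone_with d r R P \<and> c \<in> Rn d \<and> enorm d c \<le> 1 \<and> shift_agree d \<rho> c C P"
    if "0 \<le> \<rho>" for \<rho>
  proof -
    have "0 < 1 / (\<rho> + 1)" using that by simp
    then obtain P where P: "delone_with d r R P" "tiling_dist d C P < 1 / (\<rho> + 1)"
      using lim by blast
    have le_1: "1 / (\<rho> + 1) \<le> 1" using that by simp
    obtain c where "c \<in> Rn d" "enorm d c \<le> 1 / (\<rho> + 1)"
      "shift_agree d (1 / (1 / (\<rho> + 1)) - 1) c C P"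
      using tiling_dist_lessE[OF P(2) le_1] by blast
    with le_1 show ?thesis using P(1) by (intro exI[of _ P] exI[of _ c]) simp
  qed
  show ?thesis
    unfolding delone_with_def
  proof (intro conjI ballI impI)
    fix x y assume xy: "x \<in> C" "y \<in> C" "x \<noteq> y"
    then obtain P c where P: "delone_with d r R P" "shift_agree d (enorm d x + enorm d y) c C P"
      using near[of "enorm d x + enorm d y"] enorm_nonneg by (metis add_nonneg_nonneg)
    then have "x + c \<in> P" "y + c \<in> P"
      using xy assms(1) enorm_nonneg[of d x] enorm_nonneg[of d y]
      unfolding shift_agree_def by auto
    moreover have "x + c \<noteq> y + c" using xy by simp
    ultimately have "r \<le> enorm d ((x + c) - (y + c))" using P unfolding delone_with_def by blast
    then show "r \<le> enorm d (x - y)" by simp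
  next
    fix x assume x: "x \<in> Rn d"
    obtain P c where P: "delone_with d r R P" "c \<in> Rn d" "shift_agree d (enorm d x + R) c C P"
      using near[of "enorm d x + R"] enorm_nonneg[of d x] R by auto
    then obtain p where p: "p \<in> P" "p \<in> Rn d" "enorm d (p - (x + c)) \<le> R"
      using x Rn_add unfolding delone_with_def eball_def by blast
    have eq: "p - (x + c) = (p - c) - x" by simp
    have "enorm d (p - c) \<le> enorm d x + R"
      using enorm_triangle[of d "(p - c) - x" x] p(3) unfolding eq by simp
    moreover have "p - c \<in> Rn d" using p P Rn_diff by blast
    ultimately have "p - c \<in> C" using P(3) p(1) unfolding shift_agree_def by auto
    then show "C \<inter> eball d x R \<noteq> {}"
      using \<open>p - c \<in> Rn d\<close> p(3) unfolding eq by (auto simp: eball_def)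
  qed (use assms in auto)
qed

lemma enorm_component_le: "x \<in> Rn d \<Longrightarrow> \<bar>x j\<bar> \<le> enorm d x"
proof (cases "j < d")
  case True
  then have "\<bar>x j\<bar> \<le> L2_set (\<lambda>i. \<bar>x i\<bar>) {..<d}" by (intro member_le_L2_set) auto
  then show ?thesis by (simp add: enorm_def L2_set_def)
next
  case False
  moreover assume "x \<in> Rn d"
  ultimately show ?thesis
    using enorm_nonneg[of d x] by (simp add: Rn_def topspace_Euclidean_space)
qed

text \<open>\<open>T k\<close> is the sum of \<open>c i\<close> over \<open>i \<ge> k\<close>, taken
  coordinate by coordinate because the metric of the function type is not the Euclidean one. The
  bound is the tail of the geometric series.\<close>

lemma tails_of_geometric_series:
  assumes c: "\<And>k::nat. c k \<in> Rn d" "\<And>k. enorm d (c k) \<le> (1/2) ^ (k + 2)"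
  obtains T where "\<And>k. T k \<in> Rn d" "\<And>k. enorm d (T k) \<le> (1/2) ^ (k + 1)"
    "\<And>k. T k = c k + T (Suc k)"
proof
  define T where "T k = (\<lambda>j. \<Sum>i. c (i + k) j)" for k
  have geo: "summable (\<lambda>i. (1/2) ^ (i + 2) :: real)"
    unfolding power_add by (intro summable_mult2 summable_geometric) auto
  have summable: "summable (\<lambda>i. c i j)" for j
  proof (rule summable_comparison_test'[OF geo])
    show "norm (c i j) \<le> (1/2) ^ (i + 2)" if "0 \<le> i" for i
      using enorm_component_le[OF c(1), of i j] c(2)[of i] by simp
  qed
  \<comment> \<open>Keeping the remaining tail as a subtracted term makes the induction
    close.\<close>
  have partial: "enorm d (\<lambda>j. \<Sum>i<n. c (i + k) j) \<le> (1/2) ^ (k + 1) - (1/2) ^ (n + k + 1)" for n k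
  proof (induction n)
    case 0
    have "(\<lambda>j. \<Sum>i<0. c (i + k) j) = (0 :: nat \<Rightarrow> real)" by (simp add: fun_eq_iff)
    then show ?case by (simp add: enorm_0)
  next
    case (Suc n)
    have "(\<lambda>j. \<Sum>i<Suc n. c (i + k) j) = (\<lambda>j. \<Sum>i<n. c (i + k) j) + c (n + k)"
      by (simp add: fun_eq_iff)
    then have "enorm d (\<lambda>j. \<Sum>i<Suc n. c (i + k) j)
      \<le> (1/2) ^ (k + 1) - (1/2) ^ (n + k + 1) + (1/2) ^ (n + k + 2)"
      using enorm_triangle[of d "\<lambda>j. \<Sum>i<n. c (i + k) j" "c (n + k)"] Suc c(2)[of "n + k"] by simp
    then show ?case by (simp add: field_simps)
  qed
  show "T k \<in> Rn d" for k
    using c(1) by (simp add: T_def Rn_def topspace_Euclidean_space)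
  show "enorm d (T k) \<le> (1/2) ^ (k + 1)" for k
  proof (rule tendsto_upperbound)
    have "(\<lambda>n. \<Sum>i<n. c (i + k) j) \<longlonglongrightarrow> T k j" for j
      unfolding T_def using summable_ignore_initial_segment[OF summable] by (rule summable_LIMSEQ)
    then show "(\<lambda>n. enorm d (\<lambda>j. \<Sum>i<n. c (i + k) j)) \<longlonglongrightarrow> enorm d (T k)"
      unfolding enorm_def L2_set_def by (intro tendsto_intros) auto
    have "enorm d (\<lambda>j. \<Sum>i<n. c (i + k) j) \<le> (1/2) ^ (k + 1)" for n
      using partial[of k n] zero_le_power[of "1/2 :: real" "n + k + 1"] by linarith
    then show "\<forall>\<^sub>F n in sequentially. enorm d (\<lambda>j. \<Sum>i<n. c (i + k) j) \<le> (1/2) ^ (k + 1)"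
      by simp
  qed simp
  show "T k = c k + T (Suc k)" for k
  proof
    fix j
    from suminf_split_head[OF summable_ignore_initial_segment[OF summable]] show "T k j = (c k + T (Suc k)) j"
      by (simp add: T_def)
  qed
qed

text \<open>
  For a fast Cauchy sequence, consecutive sets agree exactly on growing balls after shifts \<open>c k\<close>
  of summable size. Subtracting the tails \<open>T k\<close> of the shifts makes the sets eventually constant on
  every ball.
\<close>

lemma delone_with_Cauchy_limit:
  fixes \<sigma> :: "nat \<Rightarrow> (nat \<Rightarrow> real) set"
  assumes \<sigma>: "\<And>n. delone_with d r R (\<sigma> n)" and R: "0 < R"
    and Cauchy: "\<And>e. 0 < e \<Longrightarrow> \<exists>N. \<forall>m\<ge>N. \<forall>n\<ge>N. tiling_dist d (\<sigma> m) (\<sigma> n) < e"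
  obtains C where "delone_with d r R C"
    "\<And>e. 0 < e \<Longrightarrow> \<exists>N. \<forall>n\<ge>N. tiling_dist d (\<sigma> n) C < e"
proof -
  have "\<exists>N :: nat \<Rightarrow> nat. \<forall>k. \<forall>m\<ge>N k. \<forall>n\<ge>N k. tiling_dist d (\<sigma> m) (\<sigma> n) < (1/2) ^ (k + 2)"
    by (intro choice allI Cauchy) simp
  from this obtain N :: "nat \<Rightarrow> nat" where N: "\<And>k m n. N k \<le> m \<Longrightarrow> N k \<le> n \<Longrightarrow> tiling_dist d (\<sigma> m) (\<sigma> n) < (1/2) ^ (k + 2)"
    by blast
  \<comment> \<open>Partial sums bring both \<open>s k\<close> and \<open>s (Suc k)\<close> past
    \<open>N k\<close>, whether or not \<open>N\<close> is monotone.\<close>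
  define s where "s k = (\<Sum>i\<le>k. N i)" for k
  have s: "N k \<le> s k" "N k \<le> s (Suc k)" for k
    by (auto simp: s_def intro: member_le_sum trans_le_add1)
  define P where "P k = \<sigma> (s k)" for k
  have "\<exists>c. c \<in> Rn d \<and> enorm d c \<le> (1/2) ^ (k + 2) \<and> shift_agree d (2 ^ (k + 1)) c (P k) (P (Suc k))" for k
  proof -
    have "tiling_dist d (P k) (P (Suc k)) < (1/2) ^ (k + 2)"
      unfolding P_def by (intro N s)
    then obtain c where c: "c \<in> Rn d" "enorm d c \<le> (1/2) ^ (k + 2)"
      "shift_agree d (1 / (1/2) ^ (k + 2) - 1) c (P k) (P (Suc k))"
      using tiling_dist_lessE[of d "P k" "P (Suc k)" "(1/2) ^ (k + 2)"] power_le_one[of "1/2 :: real" "k + 2"] by auto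
    have "(2::real) ^ (k + 1) \<le> 1 / (1/2) ^ (k + 2) - 1"
      using one_le_power[of "2 :: real" "k + 1"] by (simp add: power_divide)
    with c show ?thesis using shift_agree_mono by blast
  qed
  then obtain c where c: "\<And>k. c k \<in> Rn d" "\<And>k. enorm d (c k) \<le> (1/2) ^ (k + 2)"
    "\<And>k. shift_agree d (2 ^ (k + 1)) (c k) (P k) (P (Suc k))"
    by metis
  obtain T where T: "\<And>k. T k \<in> Rn d" "\<And>k. enorm d (T k) \<le> (1/2) ^ (k + 1)"
    "\<And>k. T k = c k + T (Suc k)"
    using tails_of_geometric_series[of c, OF c(1,2)] by blast
  have T_half: "enorm d (T k) \<le> 1 / 2" for k
    using T(2)[of k] power_decreasing[of 1 "k + 1" "1/2 :: real"] by simp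
  \<comment> \<open>The translates of \<open>P k\<close> by \<open>T k\<close> agree on growing
    balls, so membership in all late ones is the right notion of limit.\<close>
  define C where "C = {z \<in> Rn d. \<exists>K. \<forall>k\<ge>K. z - T k \<in> P k}"
  have P_C: "shift_agree d (2 ^ k) (T k) (P k) C" for k
    unfolding shift_agree_def
  proof (intro ballI impI)
    fix z assume z: "z \<in> Rn d" "enorm d z \<le> 2 ^ k"
    \<comment> \<open>\<open>T k - T j\<close> has size at most 1, so \<open>z + T k - T j\<close>
      stays in the ball of radius \<open>2 ^ (j + 1)\<close> on which \<open>P j\<close> and
      \<open>P (Suc j)\<close> agree after the shift \<open>c j\<close>.\<close>
    have stable: "z + T k - T j \<in> P j \<longleftrightarrow> z \<in> P k" if "k \<le> j" for j
      using that
    proof (induction j rule: dec_induct)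
      case (step j)
      have "enorm d (z + T k - T j) \<le> 2 ^ k + 1"
        using z T_half[of k] T_half[of j] enorm_triangle[of d z "T k"]
          enorm_triangle_diff[of d "z + T k" "T j"] by linarith
      also have "\<dots> \<le> 2 ^ (j + 1)"
        using power_increasing[OF step(1), of "2::real"] one_le_power[of "2::real" j]
          unfolding power_add power_one_right by linarith
      finally have "z + T k - T j \<in> P j \<longleftrightarrow> z + T k - T j + c j \<in> P (Suc j)"
        using c(3)[of j] z T(1) unfolding shift_agree_def by (blast intro: Rn_add Rn_diff)
      moreover have "z + T k - T j + c j = z + T k - T (Suc j)"
        using T(3)[of j] by simp
      ultimately show ?case using step.IH by (simp only:)
    qed simp
    have "z + T k \<in> C \<longleftrightarrow> (\<exists>K. \<forall>j\<ge>K. z + T k - T j \<in> P j)"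
      unfolding C_def using z T(1) Rn_add by blast
    also have "\<dots> \<longleftrightarrow> z \<in> P k"
      using stable by (metis linorder_le_cases)
    finally show "z \<in> P k \<longleftrightarrow> z + T k \<in> C" by simp
  qed
  \<comment> \<open>With \<open>e = (1/2) ^ k\<close>, the shift \<open>T k\<close> has size at most
    \<open>e / 2\<close> and the radius \<open>2 ^ k\<close> is \<open>1 / e\<close>, as
    \<open>tiling_dist_leI\<close> asks.\<close>
  have P_dist: "tiling_dist d (P k) C \<le> (1/2) ^ k" for k
  proof (rule tiling_dist_leI)
    show "shift_agree d (1 / (1/2) ^ k) (T k) (P k) C"
      using P_C[of k] by (simp add: power_divide)
  qed (use T(1,2)[of k] in auto)
  have lim: "\<exists>N. \<forall>n\<ge>N. tiling_dist d (\<sigma> n) C < e" if "0 < e" for e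
  proof -
    obtain k where k: "(1/2) ^ k < e / 2"
      using real_arch_pow_inv[of "e / 2" "1 / 2"] \<open>0 < e\<close> by auto
    have "(1/2 :: real) ^ (k + 2) \<le> (1/2) ^ k" by (intro power_decreasing) auto
    then have "tiling_dist d (\<sigma> n) C < e" if "N k \<le> n" for n
      using N[OF that s(1)] P_dist[of k] k tiling_dist_triangle[of d "\<sigma> n" C "P k"]
      unfolding P_def by linarith
    then show ?thesis by blast
  qed
  have "delone_with d r R C"
  proof (rule delone_with_limit)
    show "C \<subseteq> Rn d" unfolding C_def by blast
    fix e :: real assume "0 < e"
    then obtain n where "tiling_dist d (\<sigma> n) C < e" using lim by blast
    then show "\<exists>P. delone_with d r R P \<and> tiling_dist d C P < e"
      using \<sigma> tiling_dist_sym by metis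
  qed fact
  with lim show ?thesis using that by blast
qed


section \<open>Conjugacy from uniformly equivalent orbits\<close>

definition orbit :: "nat \<Rightarrow> (nat \<Rightarrow> real) set \<Rightarrow> (nat \<Rightarrow> real) set set" where
  "orbit d A = {translate (- x) A | x. x \<in> Rn d}"

lemma orbitI: "x \<in> Rn d \<Longrightarrow> translate (- x) A \<in> orbit d A"
  unfolding orbit_def by blast

lemma orbitE:
  assumes "P \<in> orbit d A"
  obtains x where "x \<in> Rn d" "P = translate (- x) A"
  using assms unfolding orbit_def by blast

lemma orbit_delone: "delone d A \<Longrightarrow> orbit d A \<subseteq> Collect (delone d)"
  by (auto elim!: orbitE intro: delone_translate Rn_minus)

lemma tiling_hull_eq: "tiling_hull d A = tiling_topology d closure_of orbit d A"
  by (simp add: tiling_hull_def orbit_def)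

abbreviation tiling_metric :: "nat \<Rightarrow> (nat \<Rightarrow> real) set metric" where
  "tiling_metric d \<equiv> metric (Collect (delone d), tiling_dist d)"

lemma mspace_tiling: "mspace (tiling_metric d) = Collect (delone d)"
  and mdist_tiling: "mdist (tiling_metric d) = tiling_dist d"
  and mtopology_tiling: "mtopology_of (tiling_metric d) = tiling_topology d"
  by (simp_all add: Metric_space.mspace_metric Metric_space.mdist_metric Metric_space_tiling
      mtopology_of_def tiling_topology_def)

lemma topspace_tiling: "topspace (tiling_topology d) = Collect (delone d)"
  by (metis mtopology_tiling mspace_tiling topspace_mtopology_of)

lemma Hausdorff_tiling: "Hausdorff_space (tiling_topology d)"
  unfolding tiling_topology_def
  by (rule Metric_space.Hausdorff_space_mtopology[OF Metric_space_tiling])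

lemma orbit_subset_hull: "delone d A \<Longrightarrow> orbit d A \<subseteq> tiling_hull d A"
  unfolding tiling_hull_eq by (intro closure_of_subset) (simp add: topspace_tiling orbit_delone)

lemma topspace_hull: "topspace (subtopology (tiling_topology d) (tiling_hull d A)) = tiling_hull d A"
  by (simp add: tiling_hull_eq closure_of_subset_topspace inf_absorb2)

lemma hull_dense:
  assumes "delone d A"
  shows "subtopology (tiling_topology d) (tiling_hull d A) closure_of orbit d A = tiling_hull d A"
  using orbit_subset_hull[OF assms]
  by (simp add: closure_of_subtopology inf_absorb2) (simp add: tiling_hull_eq)

text \<open>The constants of Delone sets may degenerate along a Cauchy sequence, so \<open>r\<close>
  and \<open>R\<close> are fixed. This still gives a complete target for extending maps, since all
  translates of one Delone set share its constants.\<close>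

lemma mcomplete_delone_with:
  assumes "0 < r" "0 < R"
  shows "mcomplete_of (submetric (tiling_metric d) (Collect (delone_with d r R)))"
proof -
  let ?K = "Collect (delone_with d r R)"
  have K: "?K \<subseteq> Collect (delone d)" using assms unfolding delone_iff_delone_with by blast
  interpret K: Metric_space ?K "tiling_dist d"
    using Metric_space.subspace[OF Metric_space_tiling K] .
  have "K.mcomplete"
    unfolding K.mcomplete_def
  proof (intro allI impI)
    fix \<sigma> assume \<sigma>: "K.MCauchy \<sigma>"
    have "delone_with d r R (\<sigma> n)" for n
      using \<sigma> unfolding K.MCauchy_def by auto
    moreover have "\<exists>N. \<forall>m\<ge>N. \<forall>n\<ge>N. tiling_dist d (\<sigma> m) (\<sigma> n) < e" if "0 < e" for e
    proof -
      from \<sigma>[unfolded K.MCauchy_def, THEN conjunct2, rule_format, OF that]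
      obtain N where "\<And>m n. N \<le> m \<Longrightarrow> N \<le> n \<Longrightarrow> tiling_dist d (\<sigma> m) (\<sigma> n) < e"
        by auto
      then show ?thesis by (intro exI[of _ N]) simp
    qed
    ultimately obtain C where "delone_with d r R C"
      "\<And>e. 0 < e \<Longrightarrow> \<exists>N. \<forall>n\<ge>N. tiling_dist d (\<sigma> n) C < e"
      using delone_with_Cauchy_limit[of d r R \<sigma>] assms by metis
    then have "limitin K.mtopology \<sigma> C sequentially"
      unfolding K.limit_metric_sequentially using \<open>\<And>n. delone_with d r R (\<sigma> n)\<close> by simp
    then show "\<exists>C. limitin K.mtopology \<sigma> C sequentially" by blast
  qed
  moreover have "?K \<inter> Collect (delone d) = ?K" using K by blast
  ultimately show ?thesis
    by (simp add: mcomplete_of_def mspace_tiling mdist_tiling)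
qed

text \<open>Uniform continuity also makes the map well defined: if two translates of
  \<open>A\<close> coincide, the corresponding translates of \<open>B\<close> are at distance below
  every \<open>e\<close>, hence equal. The extended map lands in the hull of \<open>B\<close>
  because a continuous map sends a closure into the closure of the image.\<close>

lemma orbit_map_extends_to_hull:
  assumes A: "delone d A" and B: "delone d B"
    and uc: "\<And>e. 0 < e \<Longrightarrow> \<exists>\<delta>>0. \<forall>x\<in>Rn d. \<forall>y\<in>Rn d.
      tiling_dist d (translate (- x) A) (translate (- y) A) < \<delta> \<longrightarrow>
      tiling_dist d (translate (- x) B) (translate (- y) B) < e"
  obtains h where
    "continuous_map (subtopology (tiling_topology d) (tiling_hull d A))
      (subtopology (tiling_topology d) (tiling_hull d B)) h"
    "\<And>x. x \<in> Rn d \<Longrightarrow> h (translate (- x) A) = translate (- x) B"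
proof -
  obtain r R where rR: "0 < r" "0 < R" "delone_with d r R B"
    using B unfolding delone_iff_delone_with by blast
  let ?K = "Collect (delone_with d r R)"
  let ?m = "tiling_metric d"
  \<comment> \<open>\<open>P\<close> does not determine \<open>x\<close> when \<open>A\<close> has
    periods; an arbitrary choice is made here, and the next fact shows that it is harmless.\<close>
  define f where "f P = translate (- (SOME x. x \<in> Rn d \<and> P = translate (- x) A)) B" for P
  have f: "f (translate (- x) A) = translate (- x) B" if x: "x \<in> Rn d" for x
  proof -
    define y where "y = (SOME y. y \<in> Rn d \<and> translate (- x) A = translate (- y) A)"
    have y: "y \<in> Rn d \<and> translate (- x) A = translate (- y) A"
      unfolding y_def
      by (rule someI_ex[of "\<lambda>y. y \<in> Rn d \<and> translate (- x) A = translate (- y) A"]) (use x in blast)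
    have del: "delone d (translate (- x) A)" "delone d (translate (- x) B)" "delone d (translate (- y) B)"
      using A B x y by (auto intro: delone_translate Rn_minus)
    have "tiling_dist d (translate (- x) A) (translate (- y) A) = 0"
      using del(1) y Metric_space.mdist_zero[OF Metric_space_tiling] by simp
    then have small: "tiling_dist d (translate (- x) B) (translate (- y) B) < e" if "0 < e" for e
    proof -
      obtain \<delta> where "0 < \<delta>" "\<forall>x\<in>Rn d. \<forall>y\<in>Rn d.
        tiling_dist d (translate (- x) A) (translate (- y) A) < \<delta> \<longrightarrow>
        tiling_dist d (translate (- x) B) (translate (- y) B) < e"
        using uc[OF \<open>0 < e\<close>] by blast
      with x y \<open>tiling_dist d (translate (- x) A) (translate (- y) A) = 0\<close> show ?thesis by simp
    qed
    have "tiling_dist d (translate (- x) B) (translate (- y) B) = 0"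
    proof (rule ccontr)
      assume "\<not> ?thesis"
      then have "0 < tiling_dist d (translate (- x) B) (translate (- y) B)"
        using tiling_dist_nonneg by (simp add: less_le)
      from small[OF this] show False by simp
    qed
    then have "translate (- x) B = translate (- y) B"
      using Metric_space.zero[OF Metric_space_tiling] del by simp
    then show ?thesis unfolding f_def y_def by simp
  qed
  have f_uc: "uniformly_continuous_map (submetric ?m (orbit d A)) (submetric ?m ?K) f"
    unfolding uniformly_continuous_map_def mspace_submetric mdist_submetric mspace_tiling mdist_tiling
  proof (intro conjI allI impI)
    show "f \<in> orbit d A \<inter> Collect (delone d) \<rightarrow> ?K \<inter> Collect (delone d)"
    proof
      fix P assume "P \<in> orbit d A \<inter> Collect (delone d)"
      then obtain x where x: "x \<in> Rn d" "P = translate (- x) A" by (auto elim: orbitE)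
      then have "f P = translate (- x) B" using f by simp
      then show "f P \<in> ?K \<inter> Collect (delone d)"
        using rR x B by (auto intro: delone_translate delone_with_translate Rn_minus)
    qed
  next
    fix e :: real assume "0 < e"
    then obtain \<delta> where "0 < \<delta>" and \<delta>: "\<forall>x\<in>Rn d. \<forall>y\<in>Rn d.
      tiling_dist d (translate (- x) A) (translate (- y) A) < \<delta> \<longrightarrow>
      tiling_dist d (translate (- x) B) (translate (- y) B) < e"
      using uc by blast
    have "tiling_dist d (f Q) (f P) < e"
      if PQ: "P \<in> orbit d A" "Q \<in> orbit d A" "tiling_dist d Q P < \<delta>" for P Q
    proof -
      obtain x y where "x \<in> Rn d" "P = translate (- x) A" "y \<in> Rn d" "Q = translate (- y) A"
        using PQ(1,2) by (auto elim!: orbitE)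
      with \<delta> PQ(3) f show ?thesis by simp
    qed
    with \<open>0 < \<delta>\<close> show "\<exists>\<delta>>0. \<forall>x\<in>orbit d A \<inter> Collect (delone d). \<forall>y\<in>orbit d A \<inter> Collect (delone d).
      tiling_dist d y x < \<delta> \<longrightarrow> tiling_dist d (f y) (f x) < e"
      by (intro exI[of _ \<delta>]) simp
  qed
  obtain h where h: "uniformly_continuous_map (submetric ?m (tiling_hull d A)) (submetric ?m ?K) h"
    "\<And>P. P \<in> orbit d A \<Longrightarrow> h P = f P"
    by (rule uniformly_continuous_map_extends_to_closure_of[OF mcomplete_delone_with[OF rR(1,2)] f_uc,
          unfolded mtopology_tiling, folded tiling_hull_eq]) (rule that)
  have h_orbit: "h (translate (- x) A) = translate (- x) B" if "x \<in> Rn d" for x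
    using h(2)[OF orbitI[OF that]] f[OF that] by simp
  have cont: "continuous_map (subtopology (tiling_topology d) (tiling_hull d A)) (tiling_topology d) h"
    using uniformly_continuous_imp_continuous_map[OF h(1)]
    unfolding mtopology_of_submetric mtopology_tiling continuous_map_in_subtopology by simp
  have "h ` tiling_hull d A \<subseteq> tiling_topology d closure_of (h ` orbit d A)"
    using continuous_map_image_closure_subset[OF cont, of "orbit d A"] hull_dense[OF A] by simp
  moreover have "h ` orbit d A \<subseteq> orbit d B"
    using h_orbit by (auto elim!: orbitE intro: orbitI)
  ultimately have "h ` tiling_hull d A \<subseteq> tiling_hull d B"
    unfolding tiling_hull_eq by (meson closure_of_mono order_trans)
  with cont have "continuous_map (subtopology (tiling_topology d) (tiling_hull d A))
      (subtopology (tiling_topology d) (tiling_hull d B)) h"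
    unfolding continuous_map_in_subtopology topspace_hull by (simp add: image_subset_iff_funcset)
  with h_orbit that show ?thesis by blast
qed

text \<open>Translating by \<open>t\<close> moves the ball of agreement off centre, at a cost of
  \<open>enorm d t\<close> in its radius.\<close>

lemma continuous_map_translate:
  assumes t: "t \<in> Rn d"
  shows "continuous_map (tiling_topology d) (tiling_topology d) (translate t)"
proof -
  interpret Metric_space "Collect (delone d)" "tiling_dist d" by (rule Metric_space_tiling)
  show ?thesis
    unfolding tiling_topology_def metric_continuous_map[OF Metric_space_axioms]
  proof (intro conjI ballI allI impI)
    show "translate t ` Collect (delone d) \<subseteq> Collect (delone d)"
      using delone_translate t by auto
    fix P and e :: real assume "P \<in> Collect (delone d)" and e: "0 < e"
    define \<epsilon> where "\<epsilon> = e / 2"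
    \<comment> \<open>Radius \<open>1 / \<epsilon>\<close> is wanted in the end;
      \<open>enorm d t\<close> is lost to the translation and 1 to
      \<open>tiling_dist_lessE\<close>.\<close>
    define \<rho> where "\<rho> = 1 / \<epsilon> + enorm d t + 1"
    define \<delta> where "\<delta> = min (min (\<epsilon> / 2) 1) (1 / \<rho>)"
    have \<rho>: "0 < \<rho>" using e enorm_nonneg[of d t] by (auto simp: \<rho>_def \<epsilon>_def intro: add_nonneg_pos)
    have \<delta>: "0 < \<delta>" "\<delta> \<le> \<epsilon> / 2" "\<delta> \<le> 1" using e \<rho> by (auto simp: \<delta>_def \<epsilon>_def)
    have "\<rho> \<le> 1 / \<delta>"
    proof -
      have "\<delta> \<le> 1 / \<rho>" by (simp add: \<delta>_def)
      then show ?thesis using \<rho> \<delta>(1) by (simp add: field_simps)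
    qed
    have "tiling_dist d (translate t P) (translate t Q) < e" if PQ: "tiling_dist d P Q < \<delta>" for Q
    proof -
      obtain c where c: "c \<in> Rn d" "enorm d c \<le> \<delta>" "shift_agree d (1 / \<delta> - 1) c P Q"
        using tiling_dist_lessE[OF PQ \<delta>(3)] by blast
      have "shift_agree d (1 / \<epsilon>) c (translate t P) (translate t Q)"
        using shift_agree_translate[OF c(3) t]
        by (rule shift_agree_mono) (use \<open>\<rho> \<le> 1 / \<delta>\<close> in \<open>simp add: \<rho>_def\<close>)
      then have "tiling_dist d (translate t P) (translate t Q) \<le> \<epsilon>"
        using e c \<delta> by (intro tiling_dist_leI) (auto simp: \<epsilon>_def)
      then show ?thesis using e by (simp add: \<epsilon>_def)
    qed
    with \<delta>(1) show "\<exists>\<delta>>0. \<forall>Q. Q \<in> Collect (delone d) \<and> tiling_dist d P Q < \<delta> \<longrightarrow>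
        tiling_dist d (translate t P) (translate t Q) < e"
      by blast
  qed
qed

lemma translate_hull:
  assumes "delone d A" "t \<in> Rn d" "P \<in> tiling_hull d A"
  shows "translate t P \<in> tiling_hull d A"
proof -
  have "translate t ` orbit d A \<subseteq> orbit d A"
  proof clarify
    fix Q assume "Q \<in> orbit d A"
    then obtain x where "x \<in> Rn d" "Q = translate (- x) A" by (rule orbitE)
    then have "translate t Q = translate (- (x - t)) A" by (simp add: translate_translate)
    then show "translate t Q \<in> orbit d A" using \<open>x \<in> Rn d\<close> assms(2) by (metis orbitI Rn_diff)
  qed
  moreover have "translate t P \<in> tiling_topology d closure_of (translate t ` orbit d A)"
    using continuous_map_image_closure_subset[OF continuous_map_translate[OF assms(2)]] assms(3)
    unfolding tiling_hull_eq by blast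
  ultimately show ?thesis
    unfolding tiling_hull_eq using closure_of_mono by blast
qed

text \<open>The correspondence of orbits extends in both directions. Being mutually inverse and
  commuting with translations are equalities of continuous maps into Hausdorff spaces, so it
  suffices to check them on the dense orbits.\<close>

proposition topologically_conjugateI:
  assumes A: "delone d A" and B: "delone d B"
    and AB: "\<And>e. 0 < e \<Longrightarrow> \<exists>\<delta>>0. \<forall>x\<in>Rn d. \<forall>y\<in>Rn d.
      tiling_dist d (translate (- x) A) (translate (- y) A) < \<delta> \<longrightarrow>
      tiling_dist d (translate (- x) B) (translate (- y) B) < e"
    and BA: "\<And>e. 0 < e \<Longrightarrow> \<exists>\<delta>>0. \<forall>x\<in>Rn d. \<forall>y\<in>Rn d.
      tiling_dist d (translate (- x) B) (translate (- y) B) < \<delta> \<longrightarrow>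
      tiling_dist d (translate (- x) A) (translate (- y) A) < e"
  shows "topologically_conjugate d A B"
proof -
  define X where "X C = subtopology (tiling_topology d) (tiling_hull d C)" for C
  have top: "topspace (X C) = tiling_hull d C" for C
    unfolding X_def by (rule topspace_hull)
  have dense: "X C closure_of orbit d C = tiling_hull d C" if "delone d C" for C
    using hull_dense[OF that] by (simp add: X_def)
  have Hausdorff: "Hausdorff_space (X C)" for C
    unfolding X_def by (intro Hausdorff_space_subtopology Hausdorff_tiling)
  have translate: "continuous_map (X C) (X C) (translate t)" if "delone d C" "t \<in> Rn d" for C t
    using continuous_map_translate[OF that(2)] translate_hull[OF that]
    unfolding X_def
    by (intro continuous_map_into_subtopology continuous_map_from_subtopology)
       (auto simp: top[unfolded X_def])
  obtain h where h: "continuous_map (X A) (X B) h"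
    "\<And>x. x \<in> Rn d \<Longrightarrow> h (translate (- x) A) = translate (- x) B"
    using orbit_map_extends_to_hull[OF A B AB] unfolding X_def by blast
  obtain k where k: "continuous_map (X B) (X A) k"
    "\<And>x. x \<in> Rn d \<Longrightarrow> k (translate (- x) B) = translate (- x) A"
    using orbit_map_extends_to_hull[OF B A BA] unfolding X_def by blast
  have "(k \<circ> h) P = id P" if "P \<in> tiling_hull d A" for P
  proof (rule forall_in_closure_of_eq[where f = "k \<circ> h" and g = id and X = "X A" and Y = "X A"])
    show "P \<in> X A closure_of orbit d A" using that dense A by simp
    show "(k \<circ> h) Q = id Q" if "Q \<in> orbit d A" for Q
      using that h(2) k(2) by (auto elim!: orbitE)
  qed (use h k Hausdorff in \<open>auto intro: continuous_map_compose\<close>)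
  moreover have "(h \<circ> k) P = id P" if "P \<in> tiling_hull d B" for P
  proof (rule forall_in_closure_of_eq[where f = "h \<circ> k" and g = id and X = "X B" and Y = "X B"])
    show "P \<in> X B closure_of orbit d B" using that dense B by simp
    show "(h \<circ> k) Q = id Q" if "Q \<in> orbit d B" for Q
      using that h(2) k(2) by (auto elim!: orbitE)
  qed (use h k Hausdorff in \<open>auto intro: continuous_map_compose\<close>)
  ultimately have "homeomorphic_maps (X A) (X B) h k"
    unfolding homeomorphic_maps_def top using h k by simp
  then have "homeomorphic_map (X A) (X B) h"
    using homeomorphic_map_maps by blast
  moreover have "h (translate t P) = translate t (h P)" if P: "P \<in> tiling_hull d A" and t: "t \<in> Rn d" for P t
  proof -
    have "(h \<circ> translate t) P = (translate t \<circ> h) P"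
    proof (rule forall_in_closure_of_eq[where f = "h \<circ> translate t" and g = "translate t \<circ> h"
          and X = "X A" and Y = "X B"])
      show "P \<in> X A closure_of orbit d A" using P dense A by simp
      show "continuous_map (X A) (X B) (h \<circ> translate t)" "continuous_map (X A) (X B) (translate t \<circ> h)"
        by (rule continuous_map_compose[OF translate[OF A t] h(1)],
            rule continuous_map_compose[OF h(1) translate[OF B t]])
      fix Q assume "Q \<in> orbit d A"
      then obtain x where x: "x \<in> Rn d" "Q = translate (- x) A" by (rule orbitE)
      then have "translate t Q = translate (- (x - t)) A" "translate t (translate (- x) B) = translate (- (x - t)) B"
        by (simp_all add: translate_translate)
      then show "(h \<circ> translate t) Q = (translate t \<circ> h) Q"
        using h(2)[OF x(1)] h(2)[OF Rn_diff[OF x(1) t]] x(2) by simp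
    qed (rule Hausdorff)
    then show ?thesis by simp
  qed
  ultimately show ?thesis
    unfolding topologically_conjugate_def X_def by blast
qed


section \<open>Marked sequences on the line\<close>

text \<open>
  A mark \<open>0\<close> adds no point. The marks stay readable because steps of length at least \<open>5\<close> keep the
  added points away from all other points.
\<close>

definition marked_set :: "(int \<Rightarrow> nat) \<Rightarrow> (int \<Rightarrow> real) \<Rightarrow> real set" where
  "marked_set u v = range v \<union> range (\<lambda>n. v n + real (u n))"

text \<open>The two sets of the construction share the marks \<open>u\<close> and differ in
  \<open>g\<close>. Since the length of a step is a function of its mark, the marks determine
  \<open>v\<close> up to one additive constant.\<close>

locale marked_sequence =
  fixes u :: "int \<Rightarrow> nat" and g :: "nat \<Rightarrow> real" and v :: "int \<Rightarrow> real"
  assumes mark_le: "u n \<le> 2"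
    and step: "v (n + 1) = v n + g (u n)"
    and step_ge: "5 \<le> g (u n)"
    and step_le: "g (u n) \<le> 8"
begin

lemma growth:
  assumes "m \<le> n"
  shows "v m + 5 * real_of_int (n - m) \<le> v n" "v n \<le> v m + 8 * real_of_int (n - m)"
proof -
  have "v m + 5 * real_of_int (n - m) \<le> v n \<and> v n \<le> v m + 8 * real_of_int (n - m)"
    using assms
  proof (induction n rule: int_ge_induct)
    case (step n)
    then show ?case using step_ge[of n] step_le[of n] marked_sequence.step[OF marked_sequence_axioms, of n]
      by (simp add: algebra_simps)
  qed simp
  then show "v m + 5 * real_of_int (n - m) \<le> v n" "v n \<le> v m + 8 * real_of_int (n - m)" by auto
qed

lemma gap: "m < n \<Longrightarrow> v m + 5 \<le> v n"
  using growth(1)[of m n] by (smt (verit) of_int_1_le_iff)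

lemma le_iff: "v m \<le> v n \<longleftrightarrow> m \<le> n"
  using gap[of m n] gap[of n m] by (cases m n rule: linorder_cases) auto

lemma near: obtains n where "v n \<le> x" "x < v n + 8"
proof -
  \<comment> \<open>Steps have length at least 5, so \<open>x\<close> lies between
    \<open>v (- N)\<close> and \<open>v (N + 1)\<close>. Counting from \<open>- N\<close> makes the
    first index beyond \<open>x\<close> a natural number; its predecessor is the answer.\<close>
  define N where "N = (\<lceil>\<bar>x - v 0\<bar>\<rceil>)"
  have N: "\<bar>x - v 0\<bar> \<le> of_int N" "0 \<le> N" unfolding N_def by (auto intro: order_trans[of _ 0])
  have "\<exists>j::nat. x < v (- N + int j)"
  proof
    have "v 0 + 5 * real_of_int (N + 1) \<le> v (N + 1)" using growth(1)[of 0 "N + 1"] N by simp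
    moreover have "of_int N < 5 * real_of_int (N + 1)" using N(2) by simp
    ultimately have "x < v (N + 1)" using N(1) by linarith
    then show "x < v (- N + int (nat (2 * N + 1)))" using N(2) by (simp add: algebra_simps)
  qed
  define j where "j = (LEAST j. x < v (- N + int j))"
  have j: "x < v (- N + int j)" unfolding j_def by (rule LeastI_ex) fact
  have "v (- N) + 5 * real_of_int N \<le> v 0" using growth(1)[of "- N" 0] N by simp
  then have "v (- N) \<le> x" using N by linarith
  then have "j \<noteq> 0" using j by (intro notI) simp
  then obtain i where i: "j = Suc i" using not0_implies_Suc by blast
  have "\<not> x < v (- N + int i)" using not_less_Least[of i "\<lambda>j. x < v (- N + int j)"] i unfolding j_def by simp
  moreover have "x < v (- N + int i) + 8"
    using j i step[of "- N + int i"] step_le[of "- N + int i"] by (simp add: algebra_simps)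
  ultimately show ?thesis using that[of "- N + int i"] by simp
qed

lemma mem_marked_set: "p \<in> marked_set u v \<longleftrightarrow> (\<exists>n. p = v n \<or> p = v n + real (u n))"
  by (auto simp: marked_set_def)

text \<open>Indices other than \<open>n\<close> contribute nothing within distance 2 of
  \<open>v n\<close>. The value 0 is left out because \<open>v n\<close> itself always belongs to
  the set.\<close>

lemma mark_iff:
  assumes "k = 1 \<or> k = 2"
  shows "v n + real k \<in> marked_set u v \<longleftrightarrow> u n = k"
proof
  assume "v n + real k \<in> marked_set u v"
  then obtain m where m: "v n + real k = v m \<or> v n + real k = v m + real (u m)"
    by (auto simp: mem_marked_set)
  have "m = n"
    using m gap[of m n] gap[of n m] mark_le[of m] assms by (cases m n rule: linorder_cases) auto
  then show "u n = k" using m assms by auto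
qed (auto simp: mem_marked_set)

text \<open>A mark sits 1 or 2 to the right of its base, whereas the nearest point to the left of a
  base is at least 3 away. Bases are thus recognised by a test of bounded range, which carries over
  wherever two pieces agree.\<close>

lemma range_iff:
  "p \<in> range v \<longleftrightarrow> p \<in> marked_set u v \<and> p - 1 \<notin> marked_set u v \<and> p - 2 \<notin> marked_set u v"
proof
  assume "p \<in> range v"
  then obtain n where n: "p = v n" by blast
  have "v n - k \<notin> marked_set u v" if "k = 1 \<or> k = 2" for k
  proof
    assume "v n - k \<in> marked_set u v"
    then obtain m where m: "v n - k = v m \<or> v n - k = v m + real (u m)"
      by (auto simp: mem_marked_set)
    then show False
      using that gap[of m n] gap[of n m] mark_le[of m] by (cases m n rule: linorder_cases) auto
  qed
  then show "p \<in> marked_set u v \<and> p - 1 \<notin> marked_set u v \<and> p - 2 \<notin> marked_set u v"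
    using n by (auto simp: mem_marked_set)
next
  assume p: "p \<in> marked_set u v \<and> p - 1 \<notin> marked_set u v \<and> p - 2 \<notin> marked_set u v"
  then obtain n where n: "p = v n \<or> p = v n + real (u n)" by (auto simp: mem_marked_set)
  have "v n \<in> marked_set u v" by (auto simp: mem_marked_set)
  moreover have "u n = 0 \<or> u n = 1 \<or> u n = 2" using mark_le[of n] by linarith
  ultimately show "p \<in> range v" using p n by auto
qed

lemma follow:
  assumes "\<And>i. i < j \<Longrightarrow> u (n + int i) = u (m + int i)"
  shows "v (n + int j) - v n = v (m + int j) - v m"
  using assms
proof (induction j)
  case (Suc j)
  have "v (n + int (Suc j)) = v (n + int j) + g (u (n + int j))"
    "v (m + int (Suc j)) = v (m + int j) + g (u (m + int j))"
    using step[of "n + int j"] step[of "m + int j"] by (simp_all add: algebra_simps)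
  then show ?case using Suc by simp
qed simp

text \<open>\<open>v n + t\<close> is a base by \<open>range_iff\<close>; inductively, the equal
  marks found so far place the next bases at the same distance, and \<open>mark_iff\<close> reads
  the next mark there. The margins leave room for the tests 2 to the left of the first base and 2 to
  the right of the last.\<close>

lemma decode:
  assumes agree: "\<And>p. lo \<le> p \<Longrightarrow> p \<le> hi \<Longrightarrow> p \<in> marked_set u v \<longleftrightarrow> p + t \<in> marked_set u v"
    and n: "lo + 2 \<le> v n" "v (n + int J) + 2 \<le> hi"
  obtains m where "v m = v n + t" "\<And>j. j \<le> J \<Longrightarrow> u (n + int j) = u (m + int j)"
proof -
  have v_le: "v n \<le> v (n + int j)" "v (n + int j) \<le> v (n + int J)" if "j \<le> J" for j
    using that by (auto simp: le_iff)
  have "v n + t \<in> range v"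
  proof -
    have "v n \<in> marked_set u v \<and> v n - 1 \<notin> marked_set u v \<and> v n - 2 \<notin> marked_set u v"
      by (rule iffD1[OF range_iff rangeI])
    moreover have "v n \<le> hi" using n(2) v_le[of 0] by simp
    ultimately show ?thesis
      using agree[of "v n"] agree[of "v n - 1"] agree[of "v n - 2"] n(1)
      unfolding range_iff by (simp add: algebra_simps)
  qed
  then obtain m where m: "v m = v n + t" by auto
  have "u (n + int j) = u (m + int j)" if "j \<le> J" for j
    using that
  proof (induction j rule: less_induct)
    case (less j)
    then have vm: "v (m + int j) = v (n + int j) + t"
      using follow[of j n m] m by simp
    have "u (n + int j) = k \<longleftrightarrow> u (m + int j) = k" if k: "k = 1 \<or> k = 2" for k
    proof -
      have "v (n + int j) + real k \<in> marked_set u v \<longleftrightarrow> v (n + int j) + real k + t \<in> marked_set u v"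
        using v_le[OF less.prems] n k by (intro agree) auto
      moreover have "v (n + int j) + real k + t = v (m + int j) + real k" using vm by simp
      ultimately show ?thesis using mark_iff[OF k] by simp
    qed
    moreover have "u i = 0 \<or> u i = 1 \<or> u i = 2" for i using mark_le[of i] by linarith
    ultimately show ?case by metis
  qed
  with m that show ?thesis by blast
qed

text \<open>The margin 2 on the left ensures that a mark inside the window has its base at index
  \<open>n\<close> or later.\<close>

lemma encode_subset:
  assumes u: "\<And>j. j \<le> J \<Longrightarrow> u (n + int j) = u (m + int j)"
    and p: "p \<in> marked_set u v" "v n + 2 \<le> p" "p \<le> v (n + int J)"
  shows "p - v n + v m \<in> marked_set u v"
proof -
  obtain i where i: "p = v i \<or> p = v i + real (u i)" using p by (auto simp: mem_marked_set)
  then have "v n \<le> v i" "v i \<le> v (n + int J)" using p mark_le[of i] by auto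
  then have "n \<le> i" "i \<le> n + int J" by (auto simp: le_iff)
  define j where "j = nat (i - n)"
  have j: "i = n + int j" "j \<le> J" using \<open>n \<le> i\<close> \<open>i \<le> n + int J\<close> by (auto simp: j_def)
  have "v (n + int j) - v n = v (m + int j) - v m" using j u by (intro follow) auto
  then have "p - v n + v m = v (m + int j) \<or> p - v n + v m = v (m + int j) + real (u (m + int j))"
    using i j u[OF j(2)] by auto
  then show ?thesis by (auto simp: mem_marked_set)
qed

lemma encode:
  assumes u: "\<And>j. j \<le> J \<Longrightarrow> u (n + int j) = u (m + int j)"
    and p: "v n + 2 \<le> p" "p \<le> v (n + int J)"
  shows "p \<in> marked_set u v \<longleftrightarrow> p - v n + v m \<in> marked_set u v"
proof -
  \<comment> \<open>Equal marks give windows of equal length, so the reverse inclusion is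
    \<open>encode_subset\<close> with \<open>n\<close> and \<open>m\<close> exchanged.\<close>
  have len: "v (n + int J) - v n = v (m + int J) - v m" using u by (intro follow) auto
  show ?thesis
  proof
    assume "p \<in> marked_set u v"
    then show "p - v n + v m \<in> marked_set u v"
      by (rule encode_subset[of J, rotated]) (use u p in auto)
  next
    assume "p - v n + v m \<in> marked_set u v"
    then have "p - v n + v m - v m + v n \<in> marked_set u v"
      by (rule encode_subset[of J, rotated]) (use u p len in auto)
    then show "p \<in> marked_set u v" by simp
  qed
qed

text \<open>Each step is one of \<open>g 0\<close>, \<open>g 1\<close>, \<open>g 2\<close>; this is
  the source of finite local complexity.\<close>

lemma finite_increments: "finite (range (\<lambda>n. v (n + int j) - v n))"
proof (induction j)
  case (Suc j)
  have "range (\<lambda>n. v (n + int (Suc j)) - v n)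
      \<subseteq> (\<lambda>(x, k). x + g k) ` (range (\<lambda>n. v (n + int j) - v n) \<times> {..2})"
  proof clarify
    fix n
    have "v (n + int (Suc j)) - v n = (v (n + int j) - v n) + g (u (n + int j))"
      using step[of "n + int j"] by (simp add: algebra_simps)
    then show "v (n + int (Suc j)) - v n \<in> (\<lambda>(x, k). x + g k) ` (range (\<lambda>n. v (n + int j) - v n) \<times> {..2})"
      using mark_le[of "n + int j"]
      by (intro image_eqI[of _ _ "(v (n + int j) - v n, u (n + int j))"]) auto
  qed
  then show ?case by (rule finite_subset) (use Suc in auto)
qed simp

end

text \<open>Points are decoded to marks in \<open>v\<close> and encoded again in \<open>w\<close>.
  The matching translation changes from \<open>v m - v n\<close> to \<open>w m - w n\<close>, that
  is, by the variation of the displacement \<open>w - v\<close> between matched indices, which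
  \<open>window\<close> bounds. That \<open>\<rho>\<close> is independent of \<open>x\<close>,
  \<open>y\<close> and \<open>c\<close> yields uniform continuity.\<close>

lemma marked_set_transfer:
  assumes v: "marked_sequence u g v" and w: "marked_sequence u g' w"
    and close: "\<And>n. \<bar>w n - v n\<bar> \<le> 1"
    and window: "\<And>e. 0 < e \<Longrightarrow> \<exists>R::nat. \<forall>n m. (\<forall>j\<le>R. u (n + int j) = u (m + int j)) \<longrightarrow>
      \<bar>(w m - v m) - (w n - v n)\<bar> < e"
    and e: "0 < e" and \<rho>': "0 \<le> \<rho>'"
  obtains \<rho> where "0 \<le> \<rho>"
    "\<And>x y c. (\<And>z. \<bar>z\<bar> \<le> \<rho> \<Longrightarrow> z + x \<in> marked_set u v \<longleftrightarrow> z + c + y \<in> marked_set u v) \<Longrightarrow>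
      \<exists>c'. \<bar>c' - c\<bar> < e \<and>
        (\<forall>z. \<bar>z\<bar> \<le> \<rho>' \<longrightarrow> (z + x \<in> marked_set u w \<longleftrightarrow> z + c' + y \<in> marked_set u w))"
proof -
  interpret v: marked_sequence u g v by fact
  interpret w: marked_sequence u g' w by fact
  obtain R where R: "\<And>n m. (\<forall>j\<le>R. u (n + int j) = u (m + int j)) \<Longrightarrow> \<bar>(w m - v m) - (w n - v n)\<bar> < e"
    using window[OF e] by auto
  \<comment> \<open>\<open>R\<close> marks control the error; the second bound makes the window
    cover the ball. Here 29 adds up the 20 in \<open>Q\<close>, the 8 by which \<open>v n\<close>
    may fall short of \<open>x - Q\<close>, and the 1 between \<open>v\<close> and
    \<open>w\<close>.\<close>
  define J where "J = max R (nat \<lceil>2 * \<rho>' + 29\<rceil>)"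
  have J: "R \<le> J" "2 * \<rho>' + 29 \<le> real J" unfolding J_def by linarith+
  define Q where "Q = \<rho>' + 20"
  define \<rho> where "\<rho> = Q + 8 * real J + 20"
  show ?thesis
  proof
    show "0 \<le> \<rho>" using \<rho>' by (simp add: \<rho>_def Q_def)
    fix x y c
    assume agree: "\<And>z. \<bar>z\<bar> \<le> \<rho> \<Longrightarrow> z + x \<in> marked_set u v \<longleftrightarrow> z + c + y \<in> marked_set u v"
    obtain n where n: "v n \<le> x - Q" "x - Q < v n + 8" by (rule v.near)
    have n_J: "v n + 5 * real J \<le> v (n + int J)" "v (n + int J) \<le> v n + 8 * real J"
      using v.growth[of n "n + int J"] by simp_all
    obtain m where m: "v m = v n + (c + y - x)" "\<And>j. j \<le> J \<Longrightarrow> u (n + int j) = u (m + int j)"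
    proof (rule v.decode)
      fix p assume "x - \<rho> \<le> p" "p \<le> x + \<rho>"
      then have "\<bar>p - x\<bar> \<le> \<rho>" by auto
      from agree[OF this] show "p \<in> marked_set u v \<longleftrightarrow> p + (c + y - x) \<in> marked_set u v"
        by (simp add: algebra_simps)
    next
      show "x - \<rho> + 2 \<le> v n" using n by (simp add: \<rho>_def)
      show "v (n + int J) + 2 \<le> x + \<rho>" using n n_J \<rho>' by (simp add: \<rho>_def Q_def)
    qed (rule that)
    \<comment> \<open>Solves \<open>z + c' + y = z + x - w n + w m\<close>, the translation that
      \<open>encode\<close> supplies.\<close>
    define c' where "c' = w m - w n + x - y"
    have "c' - c = (w m - v m) - (w n - v n)" using m(1) by (simp add: c'_def)
    then have "\<bar>c' - c\<bar> < e" using R[of n m] m(2) J(1) by simp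
    moreover have "z + x \<in> marked_set u w \<longleftrightarrow> z + c' + y \<in> marked_set u w" if z: "\<bar>z\<bar> \<le> \<rho>'" for z
    proof -
      have "z + x \<in> marked_set u w \<longleftrightarrow> z + x - w n + w m \<in> marked_set u w"
      proof (rule w.encode)
        show "w n + 2 \<le> z + x" using z n close[of n] \<rho>' unfolding Q_def by linarith
        show "z + x \<le> w (n + int J)"
          using z n n_J(1) J(2) close[of "n + int J"] \<rho>' unfolding Q_def by linarith
      qed (rule m(2))
      then show ?thesis by (simp add: c'_def algebra_simps)
    qed
    ultimately show "\<exists>c'. \<bar>c' - c\<bar> < e \<and>
        (\<forall>z. \<bar>z\<bar> \<le> \<rho>' \<longrightarrow> (z + x \<in> marked_set u w \<longleftrightarrow> z + c' + y \<in> marked_set u w))"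
      by blast
  qed
qed

section \<open>The real line as one-dimensional space\<close>

definition pt :: "real \<Rightarrow> nat \<Rightarrow> real" where
  "pt r = (\<lambda>i. if i = 0 then r else 0)"

lemma pt_0: "pt 0 = 0" and pt_add: "pt r + pt s = pt (r + s)" and pt_diff: "pt r - pt s = pt (r - s)"
  and pt_component: "pt r 0 = r"
  by (auto simp: pt_def fun_eq_iff)

lemma pt_eq_iff: "pt r = pt s \<longleftrightarrow> r = s"
  by (metis pt_component)

lemma pt_image_iff: "pt r \<in> pt ` S \<longleftrightarrow> r \<in> S"
  by (auto simp: pt_eq_iff)

text \<open>Otherwise the dimension \<open>1\<close> is rewritten to \<open>Suc 0\<close>, where the lemmas about \<open>Rn 1\<close> no longer match.\<close>

declare One_nat_def [simp del]

lemma Rn_1: "Rn 1 = range pt"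
proof -
  have "x \<in> range pt" if "x \<in> Rn 1" for x
  proof -
    have "x = pt (x 0)"
      using that by (auto simp: Rn_def topspace_Euclidean_space pt_def fun_eq_iff)
    then show ?thesis by blast
  qed
  then show ?thesis by (auto simp: Rn_def topspace_Euclidean_space pt_def)
qed

lemma pt_Rn: "pt r \<in> Rn 1"
  by (simp add: Rn_1)

lemma enorm_pt: "enorm 1 (pt r) = \<bar>r\<bar>"
  by (simp add: enorm_def pt_def L2_set_def)

lemma pt_translate_iff: "pt z \<in> translate (- pt x) (pt ` S) \<longleftrightarrow> z + x \<in> S"
  by (simp add: mem_translate pt_add pt_image_iff)

lemma marked_set_uniform:
  assumes "marked_sequence u g v" "marked_sequence u g' w"
    and "\<And>n. \<bar>w n - v n\<bar> \<le> 1"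
    and "\<And>e. 0 < e \<Longrightarrow> \<exists>R::nat. \<forall>n m. (\<forall>j\<le>R. u (n + int j) = u (m + int j)) \<longrightarrow>
      \<bar>(w m - v m) - (w n - v n)\<bar> < e"
    and e: "0 < e"
  shows "\<exists>\<delta>>0. \<forall>x\<in>Rn 1. \<forall>y\<in>Rn 1.
    tiling_dist 1 (translate (- x) (pt ` marked_set u v)) (translate (- y) (pt ` marked_set u v)) < \<delta> \<longrightarrow>
    tiling_dist 1 (translate (- x) (pt ` marked_set u w)) (translate (- y) (pt ` marked_set u w)) < e"
proof -
  define \<epsilon> where "\<epsilon> = e / 2"
  have \<epsilon>: "0 < \<epsilon>" "\<epsilon> < e" using e by (auto simp: \<epsilon>_def)
  obtain \<rho> where \<rho>: "0 \<le> \<rho>"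
    "\<And>x y c. (\<And>z. \<bar>z\<bar> \<le> \<rho> \<Longrightarrow> z + x \<in> marked_set u v \<longleftrightarrow> z + c + y \<in> marked_set u v) \<Longrightarrow>
      \<exists>c'. \<bar>c' - c\<bar> < \<epsilon> / 4 \<and>
        (\<forall>z. \<bar>z\<bar> \<le> 1 / \<epsilon> \<longrightarrow> (z + x \<in> marked_set u w \<longleftrightarrow> z + c' + y \<in> marked_set u w))"
    using marked_set_transfer[OF assms(1-4), of "\<epsilon> / 4" "1 / \<epsilon>"] \<epsilon>(1) by auto
  \<comment> \<open>A shift of at most \<open>\<epsilon> / 4\<close> from the hypothesis and a
    change below \<open>\<epsilon> / 4\<close> from the transfer make up the
    \<open>\<epsilon> / 2\<close> of \<open>tiling_dist_leI\<close>. The other bound leaves radius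
    \<open>\<rho>\<close> after the loss of 1.\<close>
  define \<delta> where "\<delta> = min (\<epsilon> / 4) (1 / (\<rho> + 1))"
  have "0 < \<delta>" using \<epsilon> \<rho>(1) by (simp add: \<delta>_def)
  have "\<delta> \<le> 1 / (\<rho> + 1)" "\<delta> \<le> \<epsilon> / 4" by (auto simp: \<delta>_def)
  then have "\<rho> \<le> 1 / \<delta> - 1" using \<rho>(1) \<open>0 < \<delta>\<close> by (simp add: field_simps)
  have "\<delta> \<le> 1" using \<open>\<delta> \<le> 1 / (\<rho> + 1)\<close> \<rho>(1) by (smt (verit) divide_le_eq_1_pos)
  have "tiling_dist 1 (translate (- pt x) (pt ` marked_set u w)) (translate (- pt y) (pt ` marked_set u w)) < e"
    if small: "tiling_dist 1 (translate (- pt x) (pt ` marked_set u v)) (translate (- pt y) (pt ` marked_set u v)) < \<delta>"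
    for x y
  proof -
    obtain c where c: "c \<in> Rn 1" "enorm 1 c \<le> \<delta>" "shift_agree 1 (1 / \<delta> - 1) c
      (translate (- pt x) (pt ` marked_set u v)) (translate (- pt y) (pt ` marked_set u v))"
      using tiling_dist_lessE[OF small \<open>\<delta> \<le> 1\<close>] by blast
    obtain b where b: "c = pt b" using c(1) by (auto simp: Rn_1)
    have "z + x \<in> marked_set u v \<longleftrightarrow> z + b + y \<in> marked_set u v" if "\<bar>z\<bar> \<le> \<rho>" for z
    proof -
      have "enorm 1 (pt z) \<le> 1 / \<delta> - 1" using that \<open>\<rho> \<le> 1 / \<delta> - 1\<close> by (simp add: enorm_pt)
      then have "pt z \<in> translate (- pt x) (pt ` marked_set u v) \<longleftrightarrow>
          pt z + c \<in> translate (- pt y) (pt ` marked_set u v)"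
        using c(3) pt_Rn unfolding shift_agree_def by simp
      then show ?thesis unfolding b pt_add pt_translate_iff .
    qed
    from \<rho>(2)[OF this] obtain b' where b': "\<bar>b' - b\<bar> < \<epsilon> / 4"
      "\<And>z. \<bar>z\<bar> \<le> 1 / \<epsilon> \<Longrightarrow> z + x \<in> marked_set u w \<longleftrightarrow> z + b' + y \<in> marked_set u w"
      by auto
    have "tiling_dist 1 (translate (- pt x) (pt ` marked_set u w)) (translate (- pt y) (pt ` marked_set u w)) \<le> \<epsilon>"
    proof (rule tiling_dist_leI)
      show "enorm 1 (pt b') \<le> \<epsilon> / 2"
        using b'(1) c(2) \<open>\<delta> \<le> \<epsilon> / 4\<close> unfolding b enorm_pt by linarith
      show "shift_agree 1 (1 / \<epsilon>) (pt b') (translate (- pt x) (pt ` marked_set u w))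
          (translate (- pt y) (pt ` marked_set u w))"
        unfolding shift_agree_def Rn_1 using b'(2) by (auto simp: enorm_pt pt_add pt_translate_iff)
    qed (use \<epsilon> pt_Rn in auto)
    with \<epsilon> show ?thesis by simp
  qed
  with \<open>0 < \<delta>\<close> show ?thesis unfolding Rn_1 by (intro exI[of _ \<delta>]) simp
qed

section \<open>Delone property and finite local complexity of marked sets\<close>

context marked_sequence
begin

lemma mem_eball_pt: "pt p \<in> eball 1 (pt a) R \<longleftrightarrow> \<bar>p - a\<bar> \<le> R"
  by (simp add: eball_def pt_Rn pt_diff enorm_pt)

lemma delone_marked_set: "delone 1 (pt ` marked_set u v)"
  unfolding delone_def
proof (intro conjI)
  show "pt ` marked_set u v \<subseteq> Rn 1" using pt_Rn by auto
  \<comment> \<open>The bound 1 comes from a base and its own mark; points of different indices are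
    at least 3 apart.\<close>
  have sep: "1 \<le> \<bar>p - q\<bar>" if pq: "p \<in> marked_set u v" "q \<in> marked_set u v" "p \<noteq> q" for p q
  proof -
    obtain n where n: "p = v n \<or> p = v n + real (u n)" using pq by (auto simp: mem_marked_set)
    obtain m where m: "q = v m \<or> q = v m + real (u m)" using pq by (auto simp: mem_marked_set)
    show ?thesis
      using n m pq(3) gap[of n m] gap[of m n] mark_le[of n] mark_le[of m]
      by (cases m n rule: linorder_cases) auto
  qed
  show "uniformly_discrete 1 (pt ` marked_set u v)"
    unfolding uniformly_discrete_def
    by (intro exI[of _ 1]) (auto simp: pt_diff enorm_pt pt_eq_iff intro!: sep)
  show "relatively_dense 1 (pt ` marked_set u v)"
    unfolding relatively_dense_def Rn_1
  proof (intro exI[of _ 8] conjI ballI)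
    fix x assume "x \<in> range pt"
    then obtain a where a: "x = pt a" by blast
    obtain n where "v n \<le> a" "a < v n + 8" by (rule near)
    then have "pt (v n) \<in> pt ` marked_set u v \<inter> eball 1 x 8"
      by (auto simp: a mem_eball_pt pt_image_iff mem_marked_set)
    then show "pt ` marked_set u v \<inter> eball 1 x 8 \<noteq> {}" by blast
  qed simp
qed

text \<open>Seen from a base slightly to its left, every patch of radius \<open>R\<close> is a
  subset of one finite set of increments plus marks, and that set has only finitely many
  subsets.\<close>

lemma flc_marked_set: "finite_local_complexity 1 (pt ` marked_set u v)"
  unfolding finite_local_complexity_def
proof (intro allI impI)
  fix R :: real assume R: "0 < R"
  \<comment> \<open>\<open>v n\<close> lies less than 10 below \<open>a - R\<close>, 2 by choice and
    8 by \<open>near\<close>, so \<open>J\<close> steps lead beyond \<open>a + R\<close>.\<close>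
  define J where "J = nat \<lceil>2 * R + 11\<rceil>"
  have J: "2 * R + 11 \<le> real J" unfolding J_def by linarith
  define E where "E = (\<lambda>(x, k::nat). x + real k) ` ((\<Union>j\<le>J. range (\<lambda>n. v (n + int j) - v n)) \<times> {..2})"
  have "finite E" unfolding E_def using finite_increments by auto
  show "\<exists>\<P>. finite \<P> \<and> (\<forall>x\<in>Rn 1. \<exists>P\<in>\<P>. \<exists>t\<in>Rn 1. pt ` marked_set u v \<inter> eball 1 x R = translate t P)"
  proof (intro exI[of _ "Pow (pt ` E)"] conjI ballI)
    show "finite (Pow (pt ` E))" using \<open>finite E\<close> by simp
    fix x assume "x \<in> Rn 1"
    then obtain a where a: "x = pt a" by (auto simp: Rn_1)
    obtain n where n: "v n \<le> a - R - 2" "a - R - 2 < v n + 8" by (rule near)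
    define P where "P = translate (- pt (v n)) (pt ` marked_set u v \<inter> eball 1 x R)"
    have "P \<subseteq> pt ` E"
    proof
      fix s assume "s \<in> P"
      then obtain p where p: "s = pt (p - v n)" "p \<in> marked_set u v" "\<bar>p - a\<bar> \<le> R"
        by (auto simp: P_def translate_def a mem_eball_pt pt_diff)
      obtain i where i: "p = v i \<or> p = v i + real (u i)" using p by (auto simp: mem_marked_set)
      have "v n \<le> v i" using i p(3) n mark_le[of i] by auto
      moreover have "v i \<le> v (n + int J)"
        using i p(3) n J growth(1)[of n "n + int J"] by auto
      ultimately have "n \<le> i" "i \<le> n + int J" by (auto simp: le_iff)
      define j where "j = nat (i - n)"
      have j: "i = n + int j" "j \<le> J" using \<open>n \<le> i\<close> \<open>i \<le> n + int J\<close> by (auto simp: j_def)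
      obtain k :: nat where k: "k \<le> 2" "p = v i + real k" using i mark_le[of i] by (metis add_0_right of_nat_0 zero_le)
      have "p - v n = (v (n + int j) - v n) + real k" using k j by simp
      then have "p - v n \<in> E"
        unfolding E_def using j(2) k(1)
        by (intro image_eqI[of _ _ "(v (n + int j) - v n, k)"]) auto
      then show "s \<in> pt ` E" using p by blast
    qed
    moreover have "pt ` marked_set u v \<inter> eball 1 x R = translate (pt (v n)) P"
      unfolding P_def by (simp add: translate_translate translate_0)
    ultimately show "\<exists>P\<in>Pow (pt ` E). \<exists>t\<in>Rn 1. pt ` marked_set u v \<inter> eball 1 x R = translate t P"
      using pt_Rn by (intro bexI[of _ P] bexI[of _ "pt (v n)"]) auto
  qed
qed

end


section \<open>A rotation on a half line\<close>

definition \<alpha> :: real where "\<alpha> = sqrt 2 - 1"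

lemma \<alpha>_bounds: "0 < \<alpha>" "\<alpha> < 1/2"
proof -
  show "0 < \<alpha>" by (simp add: \<alpha>_def)
  have "sqrt 2 < 3/2" by (rule real_less_lsqrt) (auto simp: power2_eq_square)
  then show "\<alpha> < 1/2" by (simp add: \<alpha>_def)
qed

lemma \<alpha>_square: "\<alpha>\<^sup>2 = 1 - 2 * \<alpha>"
  by (simp add: \<alpha>_def power2_eq_square algebra_simps)

lemma sqrt_2_irrational: "sqrt 2 \<notin> \<rat>"
proof
  assume "sqrt 2 \<in> \<rat>"
  then obtain m n :: nat where mn: "n \<noteq> 0" "\<bar>sqrt 2\<bar> = real m / real n" "coprime m n"
    by (rule Rats_abs_nat_div_natE)
  then have "real m = sqrt 2 * real n" by (simp add: field_simps)
  then have "(real m)\<^sup>2 = 2 * (real n)\<^sup>2" by (simp add: power_mult_distrib)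
  then have "real (m\<^sup>2) = real (2 * n\<^sup>2)" by simp
  then have eq: "m\<^sup>2 = 2 * n\<^sup>2" by (simp only: of_nat_eq_iff)
  then have "even (m\<^sup>2)" by simp
  then have "even m" by simp
  then obtain k where "m = 2 * k" by blast
  with eq have "n\<^sup>2 = 2 * k\<^sup>2" by (simp add: power_mult_distrib)
  then have "even (n\<^sup>2)" by simp
  then have "even n" by simp
  with \<open>even m\<close> \<open>coprime m n\<close> show False by (meson coprime_common_divisor odd_one)
qed

text \<open>Makes the coefficient of \<alpha>, and with it the character given by its parity, well
  defined.\<close>

lemma \<alpha>_representation_unique:
  assumes "of_int p + of_int q * \<alpha> = of_int p' + of_int q' * \<alpha>"
  shows "q = q'"
proof (rule ccontr)
  assume "q \<noteq> q'"
  then have "sqrt 2 = of_int (p' - p + (q - q')) / of_int (q - q')"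
    using assms by (simp add: \<alpha>_def field_simps)
  also have "\<dots> \<in> \<rat>" by (intro Rats_divide Rats_of_int)
  finally show False using sqrt_2_irrational by simp
qed

text \<open>Multiplying by \<open>\<alpha>\<^sup>2 = 1 - 2 * \<alpha>\<close> turns the pair
  \<open>p, q\<close> into \<open>p + 2 * q, 5 * q + 2 * p\<close>, which keeps \<open>q\<close>
  odd. Even powers of \<alpha> have an even coefficient of \<alpha>.\<close>

lemma odd_power_\<alpha>: "\<exists>p q :: nat. odd q \<and> real q * \<alpha> = real p + \<alpha> ^ (2 * k + 1)"
proof (induction k)
  case 0
  show ?case by (rule exI[of _ 0], rule exI[of _ 1]) simp
next
  case (Suc k)
  then obtain p q :: nat where pq: "odd q" "real q * \<alpha> = real p + \<alpha> ^ (2 * k + 1)" by blast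
  have "\<alpha> ^ (2 * Suc k + 1) = \<alpha> ^ (2 * k + 1) * \<alpha>\<^sup>2"
    by (simp add: power2_eq_square power_add)
  also have "\<dots> = (real q * \<alpha> - real p) * (1 - 2 * \<alpha>)"
    using pq(2) by (simp only: \<alpha>_square) simp
  also have "\<dots> = real q * \<alpha> - real p - 2 * real q * \<alpha>\<^sup>2 + 2 * real p * \<alpha>"
    by (simp add: algebra_simps power2_eq_square)
  also have "\<dots> = real (5 * q + 2 * p) * \<alpha> - real (p + 2 * q)"
    by (simp only: \<alpha>_square) (simp add: algebra_simps)
  finally have "real (5 * q + 2 * p) * \<alpha> = real (p + 2 * q) + \<alpha> ^ (2 * Suc k + 1)" by simp
  moreover have "odd (5 * q + 2 * p)" using pq(1) by simp
  ultimately show ?case by blast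
qed

lemma odd_power_\<alpha>_tendsto: "(\<lambda>k. \<alpha> ^ (2 * k + 1)) \<longlonglongrightarrow> 0"
proof -
  have "(\<lambda>n. \<alpha> ^ n) \<longlonglongrightarrow> 0"
    using \<alpha>_bounds by (intro LIMSEQ_realpow_zero) auto
  moreover have "strict_mono (\<lambda>k::nat. 2 * k + 1)" by (auto simp: strict_mono_def)
  ultimately show ?thesis using LIMSEQ_subseq_LIMSEQ by (fastforce simp: o_def)
qed

section \<open>The broken rotation and its coding by marks\<close>

definition offset :: "int \<Rightarrow> real" where
  "offset n = (if n < 0 then 0 else frac (of_int n * \<alpha>))"

text \<open>Mark 0 occurs exactly on the negative half, so a single mark tells the halves
  apart.\<close>

definition mark :: "int \<Rightarrow> nat" where
  "mark n = (if n < 0 then 0 else if offset n + \<alpha> < 1 then 1 else 2)"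

definition rotation_point :: "int \<Rightarrow> real" where "rotation_point n = 6 * of_int n + offset n"
definition integer_point :: "int \<Rightarrow> real" where "integer_point n = 6 * of_int n"

lemma offset_bounds: "0 \<le> offset n" "offset n < 1"
  by (auto simp: offset_def frac_lt_1)

lemma offset_0: "offset 0 = 0"
  by (simp add: offset_def)

lemma offset_step:
  "offset (n + 1) = offset n + (if mark n = 0 then 0 else if mark n = 1 then \<alpha> else \<alpha> - 1)"
proof (cases "n < 0")
  case True
  \<comment> \<open>The halves meet at \<open>n = - 1\<close>: \<open>offset 0 = 0\<close> makes
    this step constant too, in accordance with its mark 0.\<close>
  then have "n + 1 < 0 \<or> n = - 1" by linarith
  then show ?thesis using True offset_0 by (auto simp: mark_def offset_def)
next
  case False
  have "frac \<alpha> = \<alpha>" using \<alpha>_bounds by (simp add: frac_eq)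
  moreover have "of_int (n + 1) * \<alpha> = of_int n * \<alpha> + \<alpha>" by (simp add: algebra_simps)
  ultimately have "frac (of_int (n + 1) * \<alpha>) = (if frac (of_int n * \<alpha>) + \<alpha> < 1
      then frac (of_int n * \<alpha>) + \<alpha> else frac (of_int n * \<alpha>) + \<alpha> - 1)"
    by (simp only: frac_add)
  then show ?thesis using False by (simp add: mark_def offset_def)
qed

interpretation A: marked_sequence mark "\<lambda>k. if k = 0 then 6 else if k = 1 then 6 + \<alpha> else 5 + \<alpha>" rotation_point
  using \<alpha>_bounds by unfold_locales (auto simp: rotation_point_def offset_step, auto simp: mark_def)

interpretation B: marked_sequence mark "\<lambda>_. 6" integer_point
  by unfold_locales (auto simp: integer_point_def mark_def)

text \<open>\<open>q * \<alpha>\<close> is congruent to \<open>\<eta>\<close> modulo 1, so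
  \<open>q\<close> steps of the rotation amount to one rotation by \<open>\<eta>\<close>.\<close>

lemma offset_skip:
  assumes "0 \<le> n" "real q * \<alpha> = real p + \<eta>" "0 \<le> \<eta>" "\<eta> < 1" "offset n + \<eta> < 1"
  shows "offset (n + int q) = offset n + \<eta>"
proof -
  have "frac (real q * \<alpha>) = \<eta>" using assms by (simp add: frac_unique_iff)
  moreover have "of_int (n + int q) * \<alpha> = of_int n * \<alpha> + real q * \<alpha>" by (simp add: algebra_simps)
  ultimately have "frac (of_int (n + int q) * \<alpha>) = frac (of_int n * \<alpha>) + \<eta>"
    using assms by (simp only: frac_add) (simp add: offset_def)
  then show ?thesis using assms(1) by (simp add: offset_def)
qed

text \<open>Equal marks mean equal increments of the offset along the window. If the window from
  \<open>n\<close> lifts the offset above \<open>1 - e\<close>, the same rise added to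
  \<open>offset m\<close> must stay below 1, which forces \<open>offset m < offset n + e\<close>.
  Exchanging \<open>n\<close> and \<open>m\<close> gives the other side.\<close>

lemma offset_window:
  assumes e: "0 < e"
  shows "\<exists>R::nat. \<forall>n m. (\<forall>j\<le>R. mark (n + int j) = mark (m + int j)) \<longrightarrow> \<bar>offset m - offset n\<bar> < e"
proof -
  have "\<forall>\<^sub>F k in sequentially. \<alpha> ^ (2 * k + 1) < e"
    using order_tendstoD(2)[OF odd_power_\<alpha>_tendsto e] .
  then obtain k where k: "\<alpha> ^ (2 * k + 1) < e" by (auto simp: eventually_sequentially)
  define \<eta> where "\<eta> = \<alpha> ^ (2 * k + 1)"
  have \<eta>: "0 < \<eta>" "\<eta> < 1" "\<eta> < e"
    using \<alpha>_bounds k power_strict_decreasing[of 0 "2 * k + 1" \<alpha>] by (auto simp: \<eta>_def)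
  obtain p q :: nat where pq: "real q * \<alpha> = real p + \<eta>"
    using odd_power_\<alpha>[of k] unfolding \<eta>_def by blast
  \<comment> \<open>\<open>N\<close> rises by \<open>\<eta>\<close> would add up to at least 1, so
    the offset passes \<open>1 - e\<close> on the way. The window length \<open>N * q\<close> does
    not depend on \<open>n\<close>.\<close>
  define N where "N = nat \<lceil>1 / \<eta>\<rceil>"
  have "1 / \<eta> \<le> real N" unfolding N_def by linarith
  then have N: "1 \<le> real N * \<eta>" using \<eta>(1) by (simp add: field_simps)
  have reach: "\<exists>j\<le>N * q. 1 - e < offset (n + int j)" if n: "0 \<le> n" for n
  proof (rule ccontr)
    assume "\<not> ?thesis"
    then have low: "offset (n + int j) + \<eta> < 1" if "j \<le> N * q" for j
      using that \<eta>(3) by force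
    have "offset (n + int (i * q)) = offset n + real i * \<eta>" if "i \<le> N" for i
      using that
    proof (induction i)
      case (Suc i)
      have "i * q \<le> N * q" using Suc.prems by simp
      then have "offset (n + int (i * q) + int q) = offset (n + int (i * q)) + \<eta>"
        using n pq \<eta> low[of "i * q"] by (intro offset_skip) auto
      then show ?case using Suc by (simp add: algebra_simps)
    qed simp
    from this[of N] show False
      using N offset_bounds(1)[of n] offset_bounds(2)[of "n + int (N * q)"] by simp
  qed
  have no_gap: "offset m < offset n + e"
    if same: "\<And>j. j \<le> N * q \<Longrightarrow> mark (n + int j) = mark (m + int j)" for n m
  proof (cases "m < 0")
    case True
    then show ?thesis using offset_bounds(1)[of n] e by (simp add: offset_def)
  next
    case False
    then have "0 \<le> m" by simp
    have "mark n = mark m" using same[of 0] by simp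
    \<comment> \<open>The rise requires \<open>n\<close> to be on the rotating half; the shared
      first mark puts it in the same half as \<open>m\<close>.\<close>
    with False have "0 \<le> n" by (auto simp: mark_def split: if_splits)
    then obtain j where j: "j \<le> N * q" "1 - e < offset (n + int j)" using reach by blast
    have "rotation_point (n + int j) - rotation_point n = rotation_point (m + int j) - rotation_point m"
      using same j(1) by (intro A.follow) auto
    then have "offset (n + int j) - offset n = offset (m + int j) - offset m" by (simp add: rotation_point_def)
    then show ?thesis using j(2) offset_bounds(2)[of "m + int j"] by linarith
  qed
  have "\<bar>offset m - offset n\<bar> < e"
    if "\<forall>j\<le>N * q. mark (n + int j) = mark (m + int j)" for n m
    using no_gap[of n m] no_gap[of m n] that by (simp add: abs_less_iff)
  then show ?thesis by blast
qed

section \<open>The two sets: conjugacy and the Meyer property\<close>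

definition rotation_set :: "(nat \<Rightarrow> real) set" where "rotation_set = pt ` marked_set mark rotation_point"
definition integer_set :: "(nat \<Rightarrow> real) set" where "integer_set = pt ` marked_set mark integer_point"

lemma rotation_integer_conjugate: "topologically_conjugate 1 rotation_set integer_set"
  unfolding rotation_set_def integer_set_def
proof (rule topologically_conjugateI[OF A.delone_marked_set B.delone_marked_set])
  have close: "\<bar>integer_point n - rotation_point n\<bar> \<le> 1" "\<bar>rotation_point n - integer_point n\<bar> \<le> 1" for n
    using offset_bounds[of n] by (auto simp: rotation_point_def integer_point_def)
  have window: "\<exists>R::nat. \<forall>n m. (\<forall>j\<le>R. mark (n + int j) = mark (m + int j)) \<longrightarrow>
      \<bar>(integer_point m - rotation_point m) - (integer_point n - rotation_point n)\<bar> < e"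
    "\<exists>R::nat. \<forall>n m. (\<forall>j\<le>R. mark (n + int j) = mark (m + int j)) \<longrightarrow>
      \<bar>(rotation_point m - integer_point m) - (rotation_point n - integer_point n)\<bar> < e" if "0 < e" for e
    using offset_window[OF that] by (simp_all add: rotation_point_def integer_point_def abs_minus_commute)
  fix e :: real assume e: "0 < e"
  show "\<exists>\<delta>>0. \<forall>x\<in>Rn 1. \<forall>y\<in>Rn 1.
    tiling_dist 1 (translate (- x) (pt ` marked_set mark rotation_point)) (translate (- y) (pt ` marked_set mark rotation_point)) < \<delta> \<longrightarrow>
    tiling_dist 1 (translate (- x) (pt ` marked_set mark integer_point)) (translate (- y) (pt ` marked_set mark integer_point)) < e"
    by (rule marked_set_uniform[OF A.marked_sequence_axioms B.marked_sequence_axioms close(1) window(1) e])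
  show "\<exists>\<delta>>0. \<forall>x\<in>Rn 1. \<forall>y\<in>Rn 1.
    tiling_dist 1 (translate (- x) (pt ` marked_set mark integer_point)) (translate (- y) (pt ` marked_set mark integer_point)) < \<delta> \<longrightarrow>
    tiling_dist 1 (translate (- x) (pt ` marked_set mark rotation_point)) (translate (- y) (pt ` marked_set mark rotation_point)) < e"
    by (rule marked_set_uniform[OF B.marked_sequence_axioms A.marked_sequence_axioms close(2) window(2) e])
qed

text \<open>A homomorphism from the integers to the circle is determined by its value
  \<open>cis \<theta>\<close> at 1 and is the restriction of a character of the line, so the
  approximation is exact. The membership of 1 makes the group closure contain every integer.\<close>

lemma harmonious_integers:
  assumes S: "S \<subseteq> \<int>" "1 \<in> S"
  shows "harmonious 1 (pt ` S)"
  unfolding harmonious_def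
proof (intro allI impI)
  fix \<phi> and \<epsilon> :: real assume \<phi>: "circle_hom (group_closure (pt ` S)) \<phi>" and "0 < \<epsilon>"
  let ?G = "group_closure (pt ` S)"
  have norm: "cmod (\<phi> a) = 1" if "a \<in> ?G" for a
    using \<phi> that by (simp add: circle_hom_def)
  have add: "\<phi> (pt (r + s)) = \<phi> (pt r) * \<phi> (pt s)" if "pt r \<in> ?G" "pt s \<in> ?G" for r s
    using \<phi> that unfolding circle_hom_def pt_add[symmetric] by blast
  define \<theta> where "\<theta> = Arg (\<phi> (pt 1))"
  have one: "pt 1 \<in> ?G" using S(2) by (intro group_closure.base) auto
  have zero: "pt 0 \<in> ?G" unfolding pt_0 by simp
  have "\<phi> (pt 1) \<noteq> 0" using norm[OF one] by auto
  then have \<phi>_1: "\<phi> (pt 1) = cis \<theta>"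
    using norm[OF one] by (simp add: \<theta>_def cis_Arg sgn_eq)
  have \<phi>_0: "\<phi> (pt 0) = 1"
    using add[OF zero zero] norm[OF zero] by (auto simp: mult_cancel_left2)
  have "pt (of_int n) \<in> ?G \<and> \<phi> (pt (of_int n)) = cis (of_int n * \<theta>)" for n
  proof (induction n rule: int_induct[where k = 0])
    case base
    show ?case using zero \<phi>_0 by simp
  next
    case (step1 n)
    have "pt (of_int (n + 1)) = pt (of_int n) + pt 1" by (simp add: pt_add)
    then have "pt (of_int (n + 1)) \<in> ?G" using step1 one by (simp only: group_closure_add)
    moreover have "\<phi> (pt (of_int (n + 1))) = cis (of_int n * \<theta>) * cis \<theta>"
      using add[of "of_int n" 1] step1 one \<phi>_1 by simp
    ultimately show ?case by (simp add: cis_mult algebra_simps)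
  next
    case (step2 n)
    have "pt (of_int (n - 1)) = pt (of_int n) - pt 1" by (simp add: pt_diff)
    then have mem: "pt (of_int (n - 1)) \<in> ?G" using step2 one by (simp only: group_closure.diff)
    then have "\<phi> (pt (of_int n)) = \<phi> (pt (of_int (n - 1))) * cis \<theta>"
      using add[of "of_int (n - 1)" 1] one \<phi>_1 by simp
    then have "\<phi> (pt (of_int (n - 1))) = cis (of_int n * \<theta>) / cis \<theta>"
      using step2 by (simp add: field_simps)
    with mem show ?case by (simp add: cis_divide algebra_simps)
  qed
  then have \<phi>_int: "\<phi> (pt (of_int n)) = cis (of_int n * \<theta>)" for n by blast
  define \<beta> :: "(nat \<Rightarrow> real) \<Rightarrow> real" where "\<beta> x = x 0 * \<theta> / (2 * pi)" for x
  have "linear_functional 1 \<beta>"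
    by (simp add: linear_functional_def \<beta>_def field_simps)
  moreover have "cmod (\<phi> a - exp (2 * of_real pi * \<i> * of_real (\<beta> a))) < \<epsilon>" if "a \<in> pt ` S" for a
  proof -
    obtain n where n: "a = pt (of_int n)" using \<open>a \<in> pt ` S\<close> S(1) by (auto elim!: Ints_cases)
    have "2 * of_real pi * \<i> * of_real (\<beta> a) = \<i> * complex_of_real (of_int n * \<theta>)"
      by (simp add: \<beta>_def n pt_component)
    then have "exp (2 * of_real pi * \<i> * of_real (\<beta> a)) = \<phi> a"
      by (simp only: n \<phi>_int cis_conv_exp)
    then show ?thesis using \<open>0 < \<epsilon>\<close> by simp
  qed
  ultimately show "\<exists>\<beta>. linear_functional 1 \<beta> \<and>
      (\<forall>a\<in>pt ` S. cmod (\<phi> a - exp (2 * of_real pi * \<i> * of_real (\<beta> a))) < \<epsilon>)"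
    by blast
qed

lemma meyer_integer_set: "meyer 1 integer_set"
  unfolding meyer_def
proof (intro conjI)
  show "integer_set \<subseteq> Rn 1" "relatively_dense 1 integer_set"
    using B.delone_marked_set by (auto simp: integer_set_def delone_def)
  \<comment> \<open>Index 0 contributes the point \<open>0 + mark 0 = 1\<close>, the generator that
    \<open>harmonious_integers\<close> asks for.\<close>
  have "mark 0 = 1" using \<alpha>_bounds by (simp add: mark_def offset_0)
  then have "1 \<in> marked_set mark integer_point"
    unfolding B.mem_marked_set by (intro exI[of _ 0]) (simp add: integer_point_def)
  moreover have "marked_set mark integer_point \<subseteq> \<int>"
    by (auto simp: marked_set_def integer_point_def)
  ultimately show "harmonious 1 integer_set"
    unfolding integer_set_def by (intro harmonious_integers)
qed

text \<open>The points of index \<open>q\<close> and \<open>- 1 - q\<close> add up to the point of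
  index \<open>- 1\<close> plus \<open>\<eta>\<close>. Parity takes the values -1, 1, 1 at these
  three points, so a character \<open>E\<close> of the line close to parity would have
  \<open>E \<eta>\<close> near -1. But once \<open>E\<close> is fixed, \<open>\<eta>\<close> can be
  taken so small that \<open>E \<eta>\<close> is near 1.\<close>

lemma not_harmonious_rotation_set: "\<not> harmonious 1 rotation_set"
proof
  assume harm: "harmonious 1 rotation_set"
  \<comment> \<open>Contains the group closure, and on it the coefficient of \<alpha> is visibly
    additive.\<close>
  define L where "L = {a :: nat \<Rightarrow> real. \<exists>p q :: int. a 0 = of_int p + of_int q * \<alpha>}"
  have "marked_set mark rotation_point \<subseteq> {r. \<exists>p q :: int. r = of_int p + of_int q * \<alpha>}"
  proof clarify
    fix r assume "r \<in> marked_set mark rotation_point"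
    then obtain n where n: "r = rotation_point n \<or> r = rotation_point n + real (mark n)" by (auto simp: A.mem_marked_set)
    have "rotation_point n = of_int (6 * n) + of_int 0 * \<alpha> \<or>
      rotation_point n = of_int (6 * n - \<lfloor>of_int n * \<alpha>\<rfloor>) + of_int n * \<alpha>"
      by (simp add: rotation_point_def offset_def frac_def)
    then obtain p q :: int where "rotation_point n = of_int p + of_int q * \<alpha>" by blast
    with n have "r = of_int p + of_int q * \<alpha> \<or> r = of_int (p + int (mark n)) + of_int q * \<alpha>" by auto
    then show "\<exists>p q :: int. r = of_int p + of_int q * \<alpha>" by blast
  qed
  then have "rotation_set \<subseteq> L" by (auto simp: rotation_set_def L_def pt_component)
  have closure: "group_closure rotation_set \<subseteq> L"
  proof
    fix a assume "a \<in> group_closure rotation_set"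
    then show "a \<in> L"
    proof (induction rule: group_closure.induct)
      case (base a)
      have "0 \<in> L" unfolding L_def by (auto intro!: exI[of _ 0])
      with base \<open>rotation_set \<subseteq> L\<close> show ?case by blast
    next
      case (diff a b)
      obtain p q :: int where "a 0 = of_int p + of_int q * \<alpha>" using diff.IH(1) unfolding L_def by blast
      moreover obtain p' q' :: int where "b 0 = of_int p' + of_int q' * \<alpha>"
        using diff.IH(2) unfolding L_def by blast
      ultimately have "(a - b) 0 = of_int (p - p') + of_int (q - q') * \<alpha>" by (simp add: algebra_simps)
      then show ?case unfolding L_def by blast
    qed
  qed
  define c where "c a = (THE q :: int. \<exists>p :: int. a 0 = of_int p + of_int q * \<alpha>)" for a :: "nat \<Rightarrow> real"
  have c: "c a = q" if "a 0 = of_int p + of_int q * \<alpha>" for a and p q :: int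
    unfolding c_def
  proof (rule the_equality)
    fix q' :: int assume "\<exists>p :: int. a 0 = of_int p + of_int q' * \<alpha>"
    then obtain p' :: int where "a 0 = of_int p' + of_int q' * \<alpha>" by blast
    with that have "of_int p' + of_int q' * \<alpha> = of_int p + of_int q * \<alpha>" by simp
    then show "q' = q" by (rule \<alpha>_representation_unique)
  qed (use that in blast)
  define \<phi> where "\<phi> a = (if even (c a) then 1 else - 1 :: complex)" for a
  have hom: "\<phi> (a + b) = \<phi> a * \<phi> b" if "a \<in> L" "b \<in> L" for a b
  proof -
    obtain p q :: int where p: "a 0 = of_int p + of_int q * \<alpha>"
      using \<open>a \<in> L\<close> unfolding L_def by blast
    obtain p' q' :: int where p': "b 0 = of_int p' + of_int q' * \<alpha>"
      using \<open>b \<in> L\<close> unfolding L_def by blast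
    from p p' have "(a + b) 0 = of_int (p + p') + of_int (q + q') * \<alpha>" by (simp add: algebra_simps)
    then have "c (a + b) = q + q'" by (rule c)
    then show ?thesis using c[of a p q, OF p] c[of b p' q', OF p'] by (auto simp: \<phi>_def)
  qed
  have "circle_hom (group_closure rotation_set) \<phi>"
    unfolding circle_hom_def
  proof (intro conjI ballI)
    show "cmod (\<phi> a) = 1" for a by (simp add: \<phi>_def)
    show "\<phi> (a + b) = \<phi> a * \<phi> b" if "a \<in> group_closure rotation_set" "b \<in> group_closure rotation_set" for a b
      using closure that by (intro hom) auto
  qed
  \<comment> \<open>With tolerance \<open>1/4\<close>, three such errors and one distance below 1
    stay under 2, the distance between 1 and -1.\<close>
  then have "\<exists>\<beta>. linear_functional 1 \<beta> \<and>
      (\<forall>a\<in>rotation_set. cmod (\<phi> a - exp (2 * of_real pi * \<i> * of_real (\<beta> a))) < 1/4)"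
    using harm unfolding harmonious_def by (meson zero_less_divide_1_iff zero_less_numeral)
  then obtain \<beta> where \<beta>: "linear_functional 1 \<beta>"
    "\<And>a. a \<in> rotation_set \<Longrightarrow> cmod (\<phi> a - exp (2 * of_real pi * \<i> * of_real (\<beta> a))) < 1/4"
    by blast
  define b where "b = \<beta> (pt 1)"
  have "\<beta> (pt r) = r * b" for r
  proof -
    have "\<beta> (\<lambda>i. r * pt 1 i) = r * \<beta> (pt 1)"
      using \<beta>(1) pt_Rn unfolding linear_functional_def by blast
    moreover have "(\<lambda>i. r * pt 1 i) = pt r" by (auto simp: pt_def)
    ultimately show ?thesis by (simp add: b_def)
  qed
  then have exp_cis: "exp (2 * of_real pi * \<i> * of_real (\<beta> (pt r))) = cis (r * (2 * pi * b))" for r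
    by (simp add: cis_conv_exp mult_ac)
  define E where "E r = cis (r * (2 * pi * b))" for r
  have E_add: "E (r + s) = E r * E s" for r s
    by (simp add: E_def cis_mult algebra_simps)
  have E: "cmod (\<phi> (pt (rotation_point n)) - E (rotation_point n)) < 1/4" for n
    using \<beta>(2)[of "pt (rotation_point n)"] exp_cis
    by (auto simp: rotation_set_def pt_image_iff A.mem_marked_set E_def)
  \<comment> \<open>\<open>k\<close> is chosen only after \<open>b\<close>: how small the power of
    \<alpha> must be depends on the frequency of \<open>E\<close>.\<close>
  have "(\<lambda>k. E (\<alpha> ^ (2 * k + 1))) \<longlonglongrightarrow> cis (0 * (2 * pi * b))"
    unfolding E_def using odd_power_\<alpha>_tendsto by (intro tendsto_intros) 
  then have "\<forall>\<^sub>F k in sequentially. dist (E (\<alpha> ^ (2 * k + 1))) 1 < 1"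
    by (intro tendstoD) auto
  then obtain k where k: "cmod (E (\<alpha> ^ (2 * k + 1)) - 1) < 1"
    by (auto simp: eventually_sequentially dist_norm)
  define \<eta> where "\<eta> = \<alpha> ^ (2 * k + 1)"
  obtain p q :: nat where pq: "odd q" "real q * \<alpha> = real p + \<eta>"
    using odd_power_\<alpha>[of k] unfolding \<eta>_def by blast
  have \<eta>: "0 \<le> \<eta>" "\<eta> < 1"
    using \<alpha>_bounds power_strict_decreasing[of 0 "2 * k + 1" \<alpha>] by (auto simp: \<eta>_def)
  have v_q: "rotation_point (int q) = 6 * real q + \<eta>"
    using offset_skip[of 0 q p \<eta>] pq \<eta> offset_0 by (simp add: rotation_point_def)
  have v_neg: "rotation_point (- 1) = - 6" "rotation_point (- 1 - int q) = - 6 - 6 * real q"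
    by (simp_all add: rotation_point_def offset_def)
  have "c (pt (rotation_point (int q))) = int q"
    by (rule c[where p = "6 * int q - int p"]) (simp add: pt_component v_q pq(2))
  then have \<phi>_q: "\<phi> (pt (rotation_point (int q))) = - 1" using pq(1) by (simp add: \<phi>_def)
  have "c (pt (rotation_point (- 1))) = 0" "c (pt (rotation_point (- 1 - int q))) = 0"
    by (rule c[where p = "- 6"], simp add: pt_component v_neg)
       (rule c[where p = "- 6 - 6 * int q"], simp add: pt_component v_neg)
  then have \<phi>_neg: "\<phi> (pt (rotation_point (- 1))) = 1" "\<phi> (pt (rotation_point (- 1 - int q))) = 1" by (simp_all add: \<phi>_def)
  define x y z where "x = E (rotation_point (int q))" and "y = E (rotation_point (- 1 - int q))" and "z = E (rotation_point (- 1))"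
  have xyz: "cmod (- 1 - x) < 1/4" "cmod (1 - y) < 1/4" "cmod (1 - z) < 1/4"
    using E[of "int q"] E[of "- 1 - int q"] E[of "- 1"] \<phi>_q \<phi>_neg by (simp_all add: x_def y_def z_def)
  have "x * y = E \<eta> * z"
    unfolding x_def y_def z_def E_add[symmetric] v_q v_neg by simp
  \<comment> \<open>On expanding, the relation cancels all but the constant 2, which is thereby
    written in terms of the four errors. The factors \<open>E \<eta>\<close> and \<open>y\<close>
    have modulus 1.\<close>
  then have "2 = E \<eta> * (1 - z) - y * (- 1 - x) + (1 - y) - (E \<eta> - 1)"
    by (simp add: algebra_simps)
  also have "cmod \<dots> \<le> cmod (1 - z) + cmod (- 1 - x) + cmod (1 - y) + cmod (E \<eta> - 1)"
  proof -
    have "cmod (E \<eta> * (1 - z)) = cmod (1 - z)" "cmod (y * (- 1 - x)) = cmod (- 1 - x)"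
      by (simp_all add: norm_mult E_def y_def)
    moreover have "cmod (r - s + t - u) \<le> cmod r + cmod s + cmod t + cmod u" for r s t u
      using norm_triangle_ineq4[of "r - s + t" u] norm_triangle_ineq[of "r - s" t]
        norm_triangle_ineq4[of r s] by linarith
    ultimately show ?thesis by metis
  qed
  also have "\<dots> < 2" using xyz k unfolding \<eta>_def by linarith
  finally show False by simp
qed

theorem theorem8p9:
  shows "\<exists>d\<ge>1. \<exists>A. delone d A \<and> finite_local_complexity d A \<and>
           (\<exists>B. delone d B \<and> meyer d B \<and> topologically_conjugate d A B) \<and>
           \<not> meyer d A"
proof (rule exI[of _ "1 :: nat"], rule conjI, simp, rule exI[of _ rotation_set], intro conjI)
  show "delone 1 rotation_set" "finite_local_complexity 1 rotation_set"
    unfolding rotation_set_def by (rule A.delone_marked_set A.flc_marked_set)+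
  show "\<exists>B. delone 1 B \<and> meyer 1 B \<and> topologically_conjugate 1 rotation_set B"
    using meyer_integer_set rotation_integer_conjugate B.delone_marked_set unfolding integer_set_def by blast
  show "\<not> meyer 1 rotation_set" using not_harmonious_rotation_set by (simp add: meyer_def)
qed

end
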